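(* Let $\xi=(\xi_1\ge\dots\ge\xi_r\ge0)$ be a partition. The $\mathfrak{g}_r$-module $\operatorname{gr}_{v_\xi^{(N)}}\mathcal{V}(\xi,N)$ does not depend on $N$; that is, for any integers $N,M$ the $\mathfrak{g}_r$-modules $\operatorname{gr}_{v_\xi^{(N)}}\mathcal{V}(\xi,N)$ and $\operatorname{gr}_{v_\xi^{(M)}}\mathcal{V}(\xi,M)$ are isomorphic.
   Context: $\mathbb{C}\langle\mathcal{X},\mathcal{Y}\rangle$ is the associative algebra generated by $\mathcal{X},\mathcal{Y}$ with the relation $\mathcal{Y}\mathcal{X}-\mathcal{X}\mathcal{Y}=\mathcal{X}$; it acts on $\mathbb{C}[x,x^{-1}]$ by $\mathcal{X}=x$, $\mathcal{Y}=x\,\partial/\partial x$, preserving each $x^N\mathbb{C}[x]$. $\mathcal{G}_r=\mathfrak{gl}_r\otimes\mathbb{C}\langle\mathcal{X},\mathcal{Y}\rangle$ is the Lie algebra of $r\times r$ matrices over this algebra with the commutator. $V_r=\mathbb{C}^r$ with standard basis $u_1,\dots,u_r$; $V_r^{(N)}=V_r\otimes(\mathbb{C}[x,x^{-1}]/x^N\mathbb{C}[x])$ is a $\mathcal{G}_r$-module with basis $u_j^i=u_j\otimes x^i$, $i<N$. $v_\xi^{(N)}=\bigwedge_{j=1}^r\bigwedge_{i=N-\xi_j}^{N-1}u_j^i\in\bigwedge^{|\xi|}V_r^{(N)}$ (with $|\xi|=\sum\xi_j$), and $\mathcal{V}(\xi,N)=U(\mathcal{G}_r)\cdot v_\xi^{(N)}$.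 Filtration and degeneration: $F^n\mathbb{C}\langle\mathcal{X},\mathcal{Y}\rangle$ is the span of $\mathcal{X}^i\mathcal{Y}^j$ with $j\le n$; its associated graded algebra is $\mathbb{C}[x,y]$. Put $F^n\mathcal{G}_r=\mathfrak{gl}_r\otimes F^n\mathbb{C}\langle\mathcal{X},\mathcal{Y}\rangle$, so $\operatorname{gr}\mathcal{G}_r=\mathfrak{g}_r:=\mathfrak{gl}_r\otimes\mathbb{C}[x,y]$. $U^{\le m}(\mathcal{G}_r)$ is the span of products $a_1\cdots a_k$ with $a_i\in F^{m_i}\mathcal{G}_r$, $\sum m_i\le m$. Set $F^m\mathcal{V}(\xi,N)=U^{\le m}(\mathcal{G}_r)\cdot v_\xi^{(N)}$; then $\operatorname{gr}_{v_\xi^{(N)}}\mathcal{V}(\xi,N)=\bigoplus_m F^m\mathcal{V}(\xi,N)/F^{m-1}\mathcal{V}(\xi,N)$ is naturally a $\mathfrak{g}_r$-module. *)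

theory Defs
  imports
    "HOL-Analysis.Finite_Cartesian_Product"
    "HOL-Analysis.Cartesian_Space"
    "HOL-Library.Poly_Mapping"
    "HOL-Computational_Algebra.Polynomial"
    "HOL-Algebra.AbelCoset"
    "HOL-Algebra.Module"
begin

section \<open>Algebras given by generators and relations\<close>

text \<open>Words are written additively so that \<^typ>\<open>'g \<Rightarrow>\<^sub>0 complex\<close>, for \<^typ>\<open>'g\<close> the type
  of words, is the free associative algebra with the convolution product of the library.\<close>

datatype 'g word = Word (letters: "'g list")

instantiation word :: (type) monoid_add
begin
definition zero_word :: "'a word" where "0 = Word []"
definition plus_word :: "'a word \<Rightarrow> 'a word \<Rightarrow> 'a word" where
  "v + w = Word (letters v @ letters w)"
instance by standard (auto simp: zero_word_def plus_word_def)
end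

type_synonym 'g free_algebra = "'g word \<Rightarrow>\<^sub>0 complex"

definition gen :: "'g \<Rightarrow> 'g free_algebra" where
  "gen a = Poly_Mapping.single (Word [a]) 1"

inductive_set two_sided_ideal :: "'a::ring_1 set \<Rightarrow> 'a set" for S where
  zero: "0 \<in> two_sided_ideal S"
| mult: "s \<in> S \<Longrightarrow> a * s * b \<in> two_sided_ideal S"
| add: "p \<in> two_sided_ideal S \<Longrightarrow> q \<in> two_sided_ideal S \<Longrightarrow> p + q \<in> two_sided_ideal S"

lemma two_sided_ideal_mult_left:
  "p \<in> two_sided_ideal S \<Longrightarrow> c * p \<in> two_sided_ideal S"
proof (induction rule: two_sided_ideal.induct)
  case (mult s a b)
  then show ?case using two_sided_ideal.mult[of s S "c * a" b] by (simp add: mult.assoc)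
qed (auto simp: distrib_left intro: two_sided_ideal.intros)

lemma two_sided_ideal_mult_right:
  "p \<in> two_sided_ideal S \<Longrightarrow> p * c \<in> two_sided_ideal S"
proof (induction rule: two_sided_ideal.induct)
  case (mult s a b)
  then show ?case using two_sided_ideal.mult[of s S a "b * c"] by (simp add: mult.assoc)
qed (auto simp: distrib_right intro: two_sided_ideal.intros)

lemma two_sided_ideal_uminus:
  "p \<in> two_sided_ideal S \<Longrightarrow> - p \<in> two_sided_ideal S"
  using two_sided_ideal_mult_left[of p S "-1"] by simp

lemma two_sided_ideal_diff:
  "p \<in> two_sided_ideal S \<Longrightarrow> q \<in> two_sided_ideal S \<Longrightarrow> p - q \<in> two_sided_ideal S"
  using two_sided_ideal.add[of p S "- q"] two_sided_ideal_uminus[of q S] by simp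

definition ideal_cong :: "'a::ring_1 set \<Rightarrow> 'a \<Rightarrow> 'a \<Rightarrow> bool" where
  "ideal_cong S p q \<longleftrightarrow> p - q \<in> two_sided_ideal S"

lemma equivp_ideal_cong: "equivp (ideal_cong S)"
proof (rule equivpI)
  show "reflp (ideal_cong S)"
    by (rule reflpI) (simp add: ideal_cong_def two_sided_ideal.zero)
  show "symp (ideal_cong S)"
    by (rule sympI) (metis ideal_cong_def minus_diff_eq two_sided_ideal_uminus)
  show "transp (ideal_cong S)"
  proof (rule transpI)
    fix p q r assume "ideal_cong S p q" "ideal_cong S q r"
    then have "(p - q) + (q - r) \<in> two_sided_ideal S"
      unfolding ideal_cong_def by (rule two_sided_ideal.add)
    then show "ideal_cong S p r" by (simp add: ideal_cong_def)
  qed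
qed

lemma ideal_cong_add:
  "ideal_cong S p p' \<Longrightarrow> ideal_cong S q q' \<Longrightarrow> ideal_cong S (p + q) (p' + q')"
  unfolding ideal_cong_def by (metis add_diff_add two_sided_ideal.add)

lemma ideal_cong_diff:
  "ideal_cong S p p' \<Longrightarrow> ideal_cong S q q' \<Longrightarrow> ideal_cong S (p - q) (p' - q')"
  unfolding ideal_cong_def
  by (drule (1) two_sided_ideal_diff) (simp add: algebra_simps)

lemma ideal_cong_uminus: "ideal_cong S p p' \<Longrightarrow> ideal_cong S (- p) (- p')"
  unfolding ideal_cong_def by (drule two_sided_ideal_uminus) (simp add: algebra_simps)

lemma ideal_cong_mult:
  assumes "ideal_cong S p p'" "ideal_cong S q q'"
  shows "ideal_cong S (p * q) (p' * q')"
proof -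
  have "p * q - p' * q' = (p - p') * q + p' * (q - q')" by (simp add: algebra_simps)
  then show ?thesis using assms unfolding ideal_cong_def
    by (simp add: two_sided_ideal.add two_sided_ideal_mult_left two_sided_ideal_mult_right)
qed

lemma lookup_mult_empty_word:
  fixes p q :: "'g free_algebra"
  shows "Poly_Mapping.lookup (p * q) 0 = Poly_Mapping.lookup p 0 * Poly_Mapping.lookup q 0"
proof -
  have "(0 = l + m) = (l = 0 \<and> m = 0)" for l m :: "'g word"
    by (cases l; cases m) (auto simp: zero_word_def plus_word_def)
  then have *: "(x when 0 = l + m) = ((x when m = 0) when l = 0)" for l m :: "'g word" and x :: complex
    by (simp add: when_def)
  show ?thesis
    by (simp only: lookup_mult * Sum_any_when_independent Sum_any_when_equal mult_when)
qed

lemma not_ideal_cong_0_1: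
  fixes S :: "'g free_algebra set"
  assumes "\<And>s. s \<in> S \<Longrightarrow> Poly_Mapping.lookup s 0 = 0"
  shows "\<not> ideal_cong S 0 1"
proof
  assume "ideal_cong S 0 1"
  then have "0 - 1 \<in> two_sided_ideal S" by (simp only: ideal_cong_def)
  moreover have "Poly_Mapping.lookup p 0 = 0" if "p \<in> two_sided_ideal S" for p
    using that by induction (auto simp: lookup_mult_empty_word lookup_add assms)
  ultimately have "Poly_Mapping.lookup (0 - 1 :: 'g free_algebra) 0 = 0" by blast
  then show False by (simp add: lookup_minus)
qed

lemma lookup_gen_empty_word [simp]: "Poly_Mapping.lookup (gen a) 0 = 0"
  by (simp add: gen_def zero_word_def lookup_single)

section \<open>Spaces of finitely supported functions\<close>

definition pscale :: "complex \<Rightarrow> ('a \<Rightarrow>\<^sub>0 complex) \<Rightarrow> ('a \<Rightarrow>\<^sub>0 complex)" where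
  "pscale c p = Poly_Mapping.map ((*) c) p"

lemma lookup_pscale [simp]:
  "Poly_Mapping.lookup (pscale c p) k = c * Poly_Mapping.lookup p k"
  unfolding pscale_def by (simp add: Poly_Mapping.map.rep_eq when_def)

interpretation pm: vector_space pscale
  by unfold_locales (auto intro!: poly_mapping_eqI simp: lookup_add algebra_simps)

lemma pscale_single [simp]:
  "pscale c (Poly_Mapping.single k d) = Poly_Mapping.single k (c * d)"
  by (rule poly_mapping_eqI) (simp add: lookup_single when_def)

text \<open>The action of a free algebra on a space of finitely supported functions, given the
  operators by which the generators act.\<close>

definition word_act :: "('g \<Rightarrow> 'v \<Rightarrow> 'v) \<Rightarrow> 'g word \<Rightarrow> 'v \<Rightarrow> 'v" where
  "word_act act w v = foldr act (letters w) v"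

definition free_act ::
  "('g \<Rightarrow> ('k \<Rightarrow>\<^sub>0 complex) \<Rightarrow> ('k \<Rightarrow>\<^sub>0 complex)) \<Rightarrow> 'g free_algebra \<Rightarrow>
   ('k \<Rightarrow>\<^sub>0 complex) \<Rightarrow> ('k \<Rightarrow>\<^sub>0 complex)" where
  "free_act act p v = (\<Sum>w\<in>Poly_Mapping.keys p. pscale (Poly_Mapping.lookup p w) (word_act act w v))"

lemma free_act_0 [simp]: "free_act act 0 v = 0"
  by (simp add: free_act_def)

lemma free_act_single [simp]:
  "free_act act (Poly_Mapping.single w c) v = pscale c (word_act act w v)"
  by (simp add: free_act_def)

lemma free_act_add: "free_act act (p + q) v = free_act act p v + free_act act q v"
  unfolding free_act_def
  by (rule setsum_keys_plus_distrib) (simp_all add: pm.scale_left_distrib)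

lemma free_act_sum: "free_act act (sum f A) v = (\<Sum>i\<in>A. free_act act (f i) v)"
  by (induction A rule: infinite_finite_induct) (simp_all add: free_act_add)

lemma free_act_uminus: "free_act act (- p) v = - free_act act p v"
  using free_act_add[of act p "- p" v] by (simp add: eq_neg_iff_add_eq_0 add.commute)

lemma free_act_diff: "free_act act (p - q) v = free_act act p v - free_act act q v"
  using free_act_add[of act p "- q" v] by (simp add: free_act_uminus)

lemma poly_mapping_sum_single:
  "p = (\<Sum>k\<in>Poly_Mapping.keys p. Poly_Mapping.single k (Poly_Mapping.lookup p k))"
  by (rule poly_mapping_eqI)
     (simp add: lookup_sum lookup_single when_def in_keys_iff)

context
  fixes act :: "'g \<Rightarrow> ('k \<Rightarrow>\<^sub>0 complex) \<Rightarrow> ('k \<Rightarrow>\<^sub>0 complex)"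
  assumes act_add: "\<And>g u v. act g (u + v) = act g u + act g v"
    and act_scale: "\<And>g c v. act g (pscale c v) = pscale c (act g v)"
begin

lemma word_act_linear:
  "word_act act w (u + v) = word_act act w u + word_act act w v"
  "word_act act w (pscale c v) = pscale c (word_act act w v)"
proof -
  have "foldr act l (u + v) = foldr act l u + foldr act l v" for l
    by (induction l) (simp_all add: act_add)
  moreover have "foldr act l (pscale c v) = pscale c (foldr act l v)" for l
    by (induction l) (simp_all add: act_scale)
  ultimately show
    "word_act act w (u + v) = word_act act w u + word_act act w v"
    "word_act act w (pscale c v) = pscale c (word_act act w v)"
    by (simp_all add: word_act_def)
qed

lemma word_act_sum: "word_act act w (sum f A) = (\<Sum>i\<in>A. word_act act w (f i))"
proof (induction A rule: infinite_finite_induct)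
  case (infinite A)
  then show ?case using word_act_linear(2)[of w 0 0] by simp
next
  case empty
  then show ?case using word_act_linear(2)[of w 0 0] by simp
qed (simp_all add: word_act_linear)

lemma free_act_mult: "free_act act (p * q) v = free_act act p (free_act act q v)"
proof -
  have "p * q = (\<Sum>k\<in>Poly_Mapping.keys p. \<Sum>l\<in>Poly_Mapping.keys q.
      Poly_Mapping.single (k + l) (Poly_Mapping.lookup p k * Poly_Mapping.lookup q l))"
    by (subst poly_mapping_sum_single[of p], subst poly_mapping_sum_single[of q])
       (simp add: sum_product mult_single)
  then have "free_act act (p * q) v = (\<Sum>k\<in>Poly_Mapping.keys p. \<Sum>l\<in>Poly_Mapping.keys q.
      pscale (Poly_Mapping.lookup p k * Poly_Mapping.lookup q l) (word_act act (k + l) v))"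
    by (simp add: free_act_sum)
  also have "\<dots> = free_act act p (free_act act q v)"
    by (simp add: free_act_def word_act_sum word_act_linear pm.scale_sum_right
        pm.scale_scale) (simp add: word_act_def plus_word_def)
  finally show ?thesis .
qed

lemma free_act_zero_right: "free_act act p 0 = 0"
  using word_act_linear(2)[of _ 0 0] by (simp add: free_act_def)

lemma free_act_ideal:
  assumes "\<And>s v. s \<in> S \<Longrightarrow> free_act act s v = 0" and "p \<in> two_sided_ideal S"
  shows "free_act act p v = 0"
  using assms(2)
  by induction (simp_all add: free_act_mult free_act_add free_act_zero_right assms(1))

end

section \<open>The algebra generated by X, Y with Y X - X Y = X\<close>

datatype xygen = GX | GY

abbreviation xy_relations :: "xygen free_algebra set" where
  "xy_relations \<equiv> {gen GY * gen GX - gen GX * gen GY - gen GX}"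

quotient_type xyalg = "xygen free_algebra" / "ideal_cong xy_relations"
  by (rule equivp_ideal_cong)

instantiation xyalg :: ring_1
begin
lift_definition zero_xyalg :: xyalg is 0 .
lift_definition one_xyalg :: xyalg is 1 .
lift_definition plus_xyalg :: "xyalg \<Rightarrow> xyalg \<Rightarrow> xyalg" is "(+)" by (rule ideal_cong_add)
lift_definition minus_xyalg :: "xyalg \<Rightarrow> xyalg \<Rightarrow> xyalg" is "(-)" by (rule ideal_cong_diff)
lift_definition uminus_xyalg :: "xyalg \<Rightarrow> xyalg" is uminus by (rule ideal_cong_uminus)
lift_definition times_xyalg :: "xyalg \<Rightarrow> xyalg \<Rightarrow> xyalg" is "(*)" by (rule ideal_cong_mult)
instance
proof
  show "(0 :: xyalg) \<noteq> 1"
    by transfer (rule not_ideal_cong_0_1, auto simp: lookup_minus lookup_mult_empty_word)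
qed (transfer, simp add: equivp_reflp[OF equivp_ideal_cong] algebra_simps)+
end

lift_definition xyX :: xyalg is "gen GX" .
lift_definition xyY :: xyalg is "gen GY" .

lift_definition xyscale :: "complex \<Rightarrow> xyalg \<Rightarrow> xyalg" is
  "\<lambda>c p. Poly_Mapping.single 0 c * p"
  by (rule ideal_cong_mult[OF equivp_reflp[OF equivp_ideal_cong]])

interpretation xy: vector_space xyscale
  by (unfold_locales; transfer)
     (simp_all add: equivp_reflp[OF equivp_ideal_cong] distrib_left single_add
       distrib_right mult_single flip: mult.assoc)

type_synonym laurent = "int \<Rightarrow>\<^sub>0 complex"

text \<open>Multiplication in \<^typ>\<open>laurent\<close> is convolution, so this is the ring of Laurent
  polynomials, with \<^term>\<open>Poly_Mapping.single i 1\<close> the monomial of degree \<^term>\<open>i\<close>.\<close>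

definition xD :: "laurent \<Rightarrow> laurent" where
  "xD f = Poly_Mapping.mapp (\<lambda>i c. of_int i * c) f"

fun xygen_act :: "xygen \<Rightarrow> laurent \<Rightarrow> laurent" where
  "xygen_act GX f = Poly_Mapping.single 1 1 * f"
| "xygen_act GY f = xD f"

lemma lookup_xD [simp]: "Poly_Mapping.lookup (xD f) i = of_int i * Poly_Mapping.lookup f i"
  unfolding xD_def by (simp add: mapp.rep_eq in_keys_iff)

lemma lookup_X_mult [simp]:
  "Poly_Mapping.lookup (Poly_Mapping.single 1 1 * (f :: laurent)) i = Poly_Mapping.lookup f (i - 1)"
proof -
  have "(i = 1 + q) = (q = i - 1)" for q by auto
  then show ?thesis
    by (simp add: lookup_mult lookup_single when_mult)
qed

lemma xygen_act_add: "xygen_act g (u + v) = xygen_act g u + xygen_act g v"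
  by (cases g) (auto intro!: poly_mapping_eqI simp: lookup_add algebra_simps)

lemma xygen_act_scale: "xygen_act g (pscale c v) = pscale c (xygen_act g v)"
  by (cases g) (auto intro!: poly_mapping_eqI)

lemmas xy_free_act_mult = free_act_mult[of xygen_act, OF xygen_act_add xygen_act_scale]

lemma free_act_gen [simp]: "free_act act (gen a) v = act a v"
  by (simp add: gen_def word_act_def)

lemma xy_relation_act: "s \<in> xy_relations \<Longrightarrow> free_act xygen_act s v = 0"
  by (simp only: singleton_iff)
     (rule poly_mapping_eqI, simp add: free_act_diff xy_free_act_mult lookup_minus left_diff_distrib)

lift_definition xy_act :: "xyalg \<Rightarrow> laurent \<Rightarrow> laurent" is "free_act xygen_act"
proof
  fix p q v assume "ideal_cong xy_relations p q"
  then have "free_act xygen_act (p - q) v = 0"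
    using free_act_ideal[of xygen_act, OF xygen_act_add xygen_act_scale xy_relation_act]
    unfolding ideal_cong_def by blast
  then show "free_act xygen_act p v = free_act xygen_act q v"
    by (simp add: free_act_diff)
qed

definition xy_filt :: "nat \<Rightarrow> xyalg set" where
  "xy_filt n = xy.span {xyX ^ i * xyY ^ j | i j. j \<le> n}"

section \<open>The Lie algebra of matrices and its enveloping algebra\<close>

text \<open>The number \<open>r\<close> is the cardinality of the index type \<^typ>\<open>'n\<close>.\<close>

type_synonym 'n glxy = "xyalg ^ 'n ^ 'n"

definition glxy_scale :: "complex \<Rightarrow> 'n::finite glxy \<Rightarrow> 'n glxy" where
  "glxy_scale c A = (\<chi> i j. xyscale c (A $ i $ j))"

definition glxy_bracket :: "'n::finite glxy \<Rightarrow> 'n glxy \<Rightarrow> 'n glxy" where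
  "glxy_bracket A B = A ** B - B ** A"

definition glxy_filt :: "nat \<Rightarrow> 'n::finite glxy set" where
  "glxy_filt n = {A. \<forall>i j. A $ i $ j \<in> xy_filt n}"

text \<open>The first two families turn the free algebra on the underlying set of the Lie algebra
  into its tensor algebra.\<close>

definition env_relations :: "'n::finite glxy free_algebra set" where
  "env_relations =
     (\<Union>A B. {gen (A + B) - gen A - gen B}) \<union>
     (\<Union>c A. {gen (glxy_scale c A) - Poly_Mapping.single 0 c * gen A}) \<union>
     (\<Union>A B. {gen A * gen B - gen B * gen A - gen (glxy_bracket A B)})"

quotient_type 'n env = "'n::finite glxy free_algebra" / "ideal_cong env_relations"
  by (rule equivp_ideal_cong)

instantiation env :: (finite) ring_1
begin
lift_definition zero_env :: "'a env" is 0 .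
lift_definition one_env :: "'a env" is 1 .
lift_definition plus_env :: "'a env \<Rightarrow> 'a env \<Rightarrow> 'a env" is "(+)" by (rule ideal_cong_add)
lift_definition minus_env :: "'a env \<Rightarrow> 'a env \<Rightarrow> 'a env" is "(-)" by (rule ideal_cong_diff)
lift_definition uminus_env :: "'a env \<Rightarrow> 'a env" is uminus by (rule ideal_cong_uminus)
lift_definition times_env :: "'a env \<Rightarrow> 'a env \<Rightarrow> 'a env" is "(*)" by (rule ideal_cong_mult)
instance
proof
  show "(0 :: 'a env) \<noteq> 1"
    by transfer (rule not_ideal_cong_0_1,
      auto simp: env_relations_def lookup_minus lookup_mult_empty_word)
qed (transfer, simp add: equivp_reflp[OF equivp_ideal_cong] algebra_simps)+
end

definition env_of :: "'n::finite glxy \<Rightarrow> 'n env" where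
  "env_of A = abs_env (gen A)"

lift_definition env_scale :: "complex \<Rightarrow> 'n::finite env \<Rightarrow> 'n env" is
  "\<lambda>c p. Poly_Mapping.single 0 c * p"
  by (rule ideal_cong_mult[OF equivp_reflp[OF equivp_ideal_cong]])

interpretation env: vector_space env_scale
  by (unfold_locales; transfer)
     (simp_all add: equivp_reflp[OF equivp_ideal_cong] distrib_left single_add
       distrib_right mult_single flip: mult.assoc)

text \<open>For \<^prop>\<open>m < 0\<close> this is the zero subspace.\<close>

definition env_filt :: "int \<Rightarrow> 'n::finite env set" where
  "env_filt m = env.span {prod_list (map env_of as) | as ms.
     list_all2 (\<lambda>a n. a \<in> glxy_filt n) as ms \<and> int (sum_list ms) \<le> m}"

section \<open>Modules over a Lie algebra\<close>

text \<open>A complex vector space with an operator for each element of a Lie algebra.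
  The ring multiplication inherited from the record type of modules plays no role.\<close>

record ('g, 'a) lmodule = "(complex, 'a) module" +
  lact :: "'g \<Rightarrow> 'a \<Rightarrow> 'a"

definition vspace ::
  "'a set \<Rightarrow> ('a \<Rightarrow> 'a \<Rightarrow> 'a) \<Rightarrow> 'a \<Rightarrow> (complex \<Rightarrow> 'a \<Rightarrow> 'a) \<Rightarrow> (complex, 'a) module" where
  "vspace C pl z sc =
     \<lparr>carrier = C, monoid.mult = undefined, one = undefined, zero = z, add = pl, smult = sc\<rparr>"

definition with_action :: "(complex, 'a) module \<Rightarrow> ('g \<Rightarrow> 'a \<Rightarrow> 'a) \<Rightarrow> ('g, 'a) lmodule" where
  "with_action M act = module.extend M \<lparr>lact = act\<rparr>"

lemma vspace_simps [simp]:
  "carrier (vspace C pl z sc) = C" "add (vspace C pl z sc) = pl"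
  "zero (vspace C pl z sc) = z" "smult (vspace C pl z sc) = sc"
  by (simp_all add: vspace_def)

lemma with_action_simps [simp]:
  "carrier (with_action M act) = carrier M" "add (with_action M act) = add M"
  "zero (with_action M act) = zero M" "smult (with_action M act) = smult M"
  "lact (with_action M act) = act"
  by (simp_all add: with_action_def module.defs lmodule.defs)

definition quot_space :: "(complex, 'a, 'm) module_scheme \<Rightarrow> 'a set \<Rightarrow> (complex, 'a set) module" where
  "quot_space M S = vspace (a_rcosets\<^bsub>M\<^esub> S) (set_add M) S
     (\<lambda>c C. \<Union>x\<in>C. S +>\<^bsub>M\<^esub> (c \<odot>\<^bsub>M\<^esub> x))"

definition quot_lmodule :: "('g, 'a) lmodule \<Rightarrow> 'a set \<Rightarrow> ('g, 'a set) lmodule" where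
  "quot_lmodule M S = with_action (quot_space M S)
     (\<lambda>g C. \<Union>x\<in>C. S +>\<^bsub>M\<^esub> (lact M g x))"

definition lmodule_isomorphic :: "('g, 'a) lmodule \<Rightarrow> ('g, 'b) lmodule \<Rightarrow> bool" where
  "lmodule_isomorphic M M' \<longleftrightarrow> (\<exists>f. bij_betw f (carrier M) (carrier M') \<and>
     (\<forall>x\<in>carrier M. \<forall>y\<in>carrier M. f (x \<oplus>\<^bsub>M\<^esub> y) = f x \<oplus>\<^bsub>M'\<^esub> f y) \<and>
     (\<forall>c. \<forall>x\<in>carrier M. f (c \<odot>\<^bsub>M\<^esub> x) = c \<odot>\<^bsub>M'\<^esub> f x) \<and>
     (\<forall>g. \<forall>x\<in>carrier M. f (lact M g x) = lact M' g (f x)))"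

subsection \<open>Exterior powers\<close>

text \<open>The \<^term>\<open>k\<close>-th exterior power is the quotient of the space with basis the
  \<^term>\<open>k\<close>-tuples of elements by the multilinear and alternating relations. The Lie
  algebra acts by the Leibniz rule.\<close>

definition tuples :: "('g, 'a) lmodule \<Rightarrow> nat \<Rightarrow> 'a list set" where
  "tuples M k = {vs. length vs = k \<and> set vs \<subseteq> carrier M}"

definition tuple_space :: "('g, 'a) lmodule \<Rightarrow> nat \<Rightarrow> (complex, 'a list \<Rightarrow>\<^sub>0 complex) module" where
  "tuple_space M k = vspace {p. Poly_Mapping.keys p \<subseteq> tuples M k} (+) 0 pscale"

definition wedge_relations :: "('g, 'a) lmodule \<Rightarrow> nat \<Rightarrow> ('a list \<Rightarrow>\<^sub>0 complex) set" where
  "wedge_relations M k = pm.span (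
     {Poly_Mapping.single (us @ [x \<oplus>\<^bsub>M\<^esub> y] @ vs) 1
        - Poly_Mapping.single (us @ [x] @ vs) 1 - Poly_Mapping.single (us @ [y] @ vs) 1 | us vs x y.
        us @ [x] @ vs \<in> tuples M k \<and> y \<in> carrier M} \<union>
     {Poly_Mapping.single (us @ [c \<odot>\<^bsub>M\<^esub> x] @ vs) 1 - Poly_Mapping.single (us @ [x] @ vs) c | us vs c x.
        us @ [x] @ vs \<in> tuples M k} \<union>
     {Poly_Mapping.single vs 1 | vs. vs \<in> tuples M k \<and> \<not> distinct vs})"

definition leibniz :: "('a \<Rightarrow> 'a) \<Rightarrow> ('a list \<Rightarrow>\<^sub>0 complex) \<Rightarrow> ('a list \<Rightarrow>\<^sub>0 complex)" where
  "leibniz D p = (\<Sum>vs\<in>Poly_Mapping.keys p. \<Sum>i<length vs.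
     Poly_Mapping.single (vs[i := D (vs ! i)]) (Poly_Mapping.lookup p vs))"

definition ext_power :: "('g, 'a) lmodule \<Rightarrow> nat \<Rightarrow> ('g, ('a list \<Rightarrow>\<^sub>0 complex) set) lmodule" where
  "ext_power M k = with_action (quot_space (tuple_space M k) (wedge_relations M k))
     (\<lambda>g C. \<Union>p\<in>C. wedge_relations M k +>\<^bsub>tuple_space M k\<^esub> leibniz (lact M g) p)"

definition wedge :: "('g, 'a) lmodule \<Rightarrow> 'a list \<Rightarrow> ('a list \<Rightarrow>\<^sub>0 complex) set" where
  "wedge M vs = wedge_relations M (length vs) +>\<^bsub>tuple_space M (length vs)\<^esub> Poly_Mapping.single vs 1"

subsection \<open>Cyclic modules, their filtration and the associated graded module\<close>

text \<open>The action of the enveloping algebra on a module. For a Lie algebra action the value does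
  not depend on the representative of \<^term>\<open>u\<close> in the free algebra.\<close>

definition env_act :: "('n::finite glxy, 'a) lmodule \<Rightarrow> 'n env \<Rightarrow> 'a \<Rightarrow> 'a" where
  "env_act M u v = (let p = rep_env u in
     \<Oplus>\<^bsub>M\<^esub>w\<in>Poly_Mapping.keys p. Poly_Mapping.lookup p w \<odot>\<^bsub>M\<^esub> word_act (lact M) w v)"

definition cyclic :: "('n::finite glxy, 'a) lmodule \<Rightarrow> 'a \<Rightarrow> ('n glxy, 'a) lmodule" where
  "cyclic M v = M\<lparr>carrier := range (\<lambda>u. env_act M u v)\<rparr>"

definition filt :: "('n::finite glxy, 'a) lmodule \<Rightarrow> 'a \<Rightarrow> int \<Rightarrow> 'a set" where
  "filt M v m = (\<lambda>u. env_act M u v) ` env_filt m"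

definition gr_piece :: "('n::finite glxy, 'a) lmodule \<Rightarrow> 'a \<Rightarrow> nat \<Rightarrow> (complex, 'a set) module" where
  "gr_piece M v m = quot_space (M\<lparr>carrier := filt M v (int m)\<rparr>) (filt M v (int m - 1))"

definition direct_sum :: "(nat \<Rightarrow> (complex, 'a) module) \<Rightarrow> (complex, nat \<Rightarrow> 'a) module" where
  "direct_sum Q = vspace
     {w. (\<forall>m. w m \<in> carrier (Q m)) \<and> finite {m. w m \<noteq> \<zero>\<^bsub>Q m\<^esub>}}
     (\<lambda>w w' m. w m \<oplus>\<^bsub>Q m\<^esub> w' m) (\<lambda>m. \<zero>\<^bsub>Q m\<^esub>) (\<lambda>c w m. c \<odot>\<^bsub>Q m\<^esub> w m)"

text \<open>The Lie algebra of matrices over the polynomial ring in \<open>x\<close> and \<open>y\<close>. In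
  \<^typ>\<open>complex poly poly\<close> the outer variable is \<open>y\<close> and the inner one is \<open>x\<close>.\<close>

type_synonym 'n gxy = "complex poly poly ^ 'n ^ 'n"

text \<open>The part of \<^term>\<open>g\<close> of degree \<^term>\<open>j\<close> in \<open>y\<close>, identified with its class in the
  associated graded Lie algebra, has this representative in filtration degree \<^term>\<open>j\<close>:
  the class of \<open>X\<^sup>i Y\<^sup>j\<close> is \<open>x\<^sup>i y\<^sup>j\<close>.\<close>

definition symbol_lift :: "nat \<Rightarrow> 'n::finite gxy \<Rightarrow> 'n glxy" where
  "symbol_lift j g = (\<chi> a b. let f = coeff (g $ a $ b) j in
     (\<Sum>i\<le>degree f. xyscale (coeff f i) (xyX ^ i * xyY ^ j)))"

definition gr_module :: "('n::finite glxy, 'a) lmodule \<Rightarrow> 'a \<Rightarrow> ('n gxy, nat \<Rightarrow> 'a set) lmodule" where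
  "gr_module M v = with_action (direct_sum (gr_piece M v))
     (\<lambda>g w m. \<Oplus>\<^bsub>gr_piece M v m\<^esub>j\<in>{..m}.
        \<Union>x\<in>w (m - j). filt M v (int m - 1) +>\<^bsub>M\<^esub> lact M (symbol_lift j g) x)"

section \<open>The modules \<open>V(\<xi>, N)\<close>\<close>

type_synonym 'n lvec = "laurent ^ 'n"

definition laurent_module :: "('n::finite glxy, 'n lvec) lmodule" where
  "laurent_module = with_action (vspace UNIV (+) 0 (\<lambda>c f. \<chi> a. pscale c (f $ a)))
     (\<lambda>A f. \<chi> a. \<Sum>b\<in>UNIV. xy_act (A $ a $ b) (f $ b))"

definition xN_polys :: "int \<Rightarrow> laurent set" where
  "xN_polys N = {Poly_Mapping.single N 1 * p | p. Poly_Mapping.keys p \<subseteq> {0..}}"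

definition VN :: "int \<Rightarrow> ('n::finite glxy, ('n lvec) set) lmodule" where
  "VN N = quot_lmodule laurent_module {f. \<forall>a. f $ a \<in> xN_polys N}"

definition VN_basis :: "int \<Rightarrow> 'n::finite \<Rightarrow> int \<Rightarrow> ('n lvec) set" where
  "VN_basis N j i = {f. \<forall>a. f $ a \<in> xN_polys N} +>\<^bsub>laurent_module\<^esub> axis j (Poly_Mapping.single i 1)"

definition v_xi :: "('n::{finite,linorder} \<Rightarrow> nat) \<Rightarrow> int \<Rightarrow> (('n lvec) set list \<Rightarrow>\<^sub>0 complex) set" where
  "v_xi \<xi> N = wedge (VN N) (concat (map
     (\<lambda>j. map (VN_basis N j) [N - int (\<xi> j)..N - 1]) (sorted_list_of_set UNIV)))"

definition V_xi ::
  "('n::{finite,linorder} \<Rightarrow> nat) \<Rightarrow> int \<Rightarrow> ('n glxy, (('n lvec) set list \<Rightarrow>\<^sub>0 complex) set) lmodule" where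
  "V_xi \<xi> N = cyclic (ext_power (VN N) (\<Sum>j\<in>UNIV. \<xi> j)) (v_xi \<xi> N)"

end

theory Submission
  imports Defs
begin

text \<open>
Put \<open>c = M - N\<close>. Multiplication by \<open>x\<^sup>c\<close> maps \<open>x\<^sup>N \<complex>[x]\<close> onto \<open>x\<^sup>M \<complex>[x]\<close>, so it induces
a linear isomorphism between the truncated spaces for \<open>N\<close> and \<open>M\<close>, then between their exterior
powers, and the latter takes \<open>v_xi \<xi> N\<close> to \<open>v_xi \<xi> M\<close>. It commutes with \<open>X\<close> but not with \<open>Y\<close>:
the operator \<open>Y\<close> on the first space becomes \<open>Y - c\<close> on the second one. Hence
\<open>X\<^sup>i Y\<^sup>j\<close> corresponds to \<open>X\<^sup>i (Y - c)\<^sup>j\<close>, which has the same leading term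
(\<open>xy_shift_monomial\<close>): an element of degree \<open>n\<close> of the Lie algebra corresponds to one that
differs from it in degree \<open>n - 1\<close> only (\<open>glxy_twist_exists\<close>).

Such an isomorphism respects everything that the associated graded module is made of. A filtration
step is spanned by the words of bounded degree applied to the generator (\<open>filt_eq_lspan\<close>), and
replacing each letter by its partner keeps the degree, so filtration steps are mapped onto
filtration steps (\<open>f_filt\<close>). A symbol of degree \<open>j\<close> acts by a representative in filtration
degree \<open>j\<close>; passing to the partner changes the result by an element of the next lower filtration
step, which is zero in the graded piece (\<open>action_component\<close>). So the induced bijection of graded
pieces is linear over the associated graded Lie algebra (\<open>gr_module_isomorphic\<close>).

The description of the filtration by words presupposes that the enveloping algebra acts on the
exterior power independently of representatives (\<open>env_act_abs\<close>). For this the truncated spaces and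
their exterior powers have to be shown to be modules over the Lie algebra (\<open>VN_lie_module\<close>,
\<open>ext_power_lie_module\<close>).
\<close>

section \<open>Complex vector spaces and their quotients\<close>

text \<open>The scalars are the type of complex numbers itself, while the vectors live on a carrier. All the
modules of the theorem are iterated quotients of this kind: their elements are sets, sets of
formal sums of lists of sets, and so on.\<close>

locale complex_space = abelian_group M for M :: "(complex, 'a, 'm) module_scheme" (structure) +
  assumes smult_closed [intro, simp]: "x \<in> carrier M \<Longrightarrow> c \<odot> x \<in> carrier M"
    and smult_add_left: "x \<in> carrier M \<Longrightarrow> (c + d) \<odot> x = (c \<odot> x) \<oplus> (d \<odot> x)"
    and smult_add_right: "x \<in> carrier M \<Longrightarrow> y \<in> carrier M \<Longrightarrow> c \<odot> (x \<oplus> y) = (c \<odot> x) \<oplus> (c \<odot> y)"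
    and smult_smult: "x \<in> carrier M \<Longrightarrow> c \<odot> (d \<odot> x) = (c * d) \<odot> x"
    and smult_one [simp]: "x \<in> carrier M \<Longrightarrow> 1 \<odot> x = x"

definition subspace_of :: "(complex, 'a, 'm) module_scheme \<Rightarrow> 'a set \<Rightarrow> bool" where
  "subspace_of M S \<longleftrightarrow> S \<subseteq> carrier M \<and> \<zero>\<^bsub>M\<^esub> \<in> S \<and> (\<forall>x\<in>S. \<forall>y\<in>S. x \<oplus>\<^bsub>M\<^esub> y \<in> S) \<and>
     (\<forall>c. \<forall>x\<in>S. c \<odot>\<^bsub>M\<^esub> x \<in> S)"

definition linear_iso ::
  "('a \<Rightarrow> 'b) \<Rightarrow> (complex, 'a, 'm) module_scheme \<Rightarrow> (complex, 'b, 'k) module_scheme \<Rightarrow> bool" where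
  "linear_iso f M M' \<longleftrightarrow> bij_betw f (carrier M) (carrier M') \<and>
     (\<forall>x\<in>carrier M. \<forall>y\<in>carrier M. f (x \<oplus>\<^bsub>M\<^esub> y) = f x \<oplus>\<^bsub>M'\<^esub> f y) \<and>
     (\<forall>c. \<forall>x\<in>carrier M. f (c \<odot>\<^bsub>M\<^esub> x) = c \<odot>\<^bsub>M'\<^esub> f x)"

lemma (in complex_space) smult_zero_left [simp]:
  assumes "x \<in> carrier M" shows "0 \<odot> x = \<zero>"
proof -
  have "(0 \<odot> x) \<oplus> (0 \<odot> x) = (0 \<odot> x) \<oplus> \<zero>"
    using smult_add_left[of x 0 0] assms by simp
  then have "\<ominus> (0 \<odot> x) \<oplus> ((0 \<odot> x) \<oplus> (0 \<odot> x)) = \<ominus> (0 \<odot> x) \<oplus> ((0 \<odot> x) \<oplus> \<zero>)"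
    by (rule arg_cong)
  then show ?thesis using assms by (simp add: r_neg1 l_neg)
qed

lemma (in complex_space) smult_zero_right [simp]: "c \<odot> \<zero> = \<zero>"
  using smult_smult[of \<zero> c 0] by simp

lemma (in complex_space) smult_minus_one:
  assumes "x \<in> carrier M" shows "(-1) \<odot> x = \<ominus> x"
proof -
  have "((-1) \<odot> x) \<oplus> (1 \<odot> x) = (-1 + 1) \<odot> x" by (rule smult_add_left[symmetric, OF assms])
  then show ?thesis using assms by (simp add: minus_equality)
qed

lemma finsum_additive:
  assumes "abelian_monoid M" "abelian_monoid M'"
    and "\<And>x. x \<in> carrier M \<Longrightarrow> h x \<in> carrier M'"
    and "\<And>x y. x \<in> carrier M \<Longrightarrow> y \<in> carrier M \<Longrightarrow> h (x \<oplus>\<^bsub>M\<^esub> y) = h x \<oplus>\<^bsub>M'\<^esub> h y"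
    and "h \<zero>\<^bsub>M\<^esub> = \<zero>\<^bsub>M'\<^esub>"
    and "f \<in> A \<rightarrow> carrier M"
  shows "h (finsum M f A) = finsum M' (\<lambda>i. h (f i)) A"
proof -
  interpret M: abelian_monoid M by fact
  interpret M': abelian_monoid M' by fact
  show ?thesis using assms(6)
    by (induction A rule: infinite_finite_induct) (simp_all add: Pi_def assms(3-5))
qed

lemma linear_iso_zero:
  assumes "complex_space M" "complex_space M'" "linear_iso f M M'"
  shows "f \<zero>\<^bsub>M\<^esub> = \<zero>\<^bsub>M'\<^esub>"
proof -
  interpret M: complex_space M by fact
  interpret M': complex_space M' by fact
  have "f \<zero>\<^bsub>M\<^esub> \<in> carrier M'"
    using assms(3) M.zero_closed unfolding linear_iso_def bij_betw_def by blast
  moreover have "f (0 \<odot>\<^bsub>M\<^esub> \<zero>\<^bsub>M\<^esub>) = 0 \<odot>\<^bsub>M'\<^esub> f \<zero>\<^bsub>M\<^esub>"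
    using assms(3) M.zero_closed unfolding linear_iso_def by blast
  ultimately show ?thesis by simp
qed

subsection \<open>Subspaces and quotients\<close>

context complex_space
begin

lemma subspace_abelian_subgroup:
  assumes "subspace_of M S" shows "abelian_subgroup S M"
proof -
  have "a_inv M x \<in> S" if "x \<in> S" for x
    using assms that smult_minus_one[of x] unfolding subspace_of_def by (metis subsetD)
  then have "subgroup S (add_monoid M)"
    using assms by (intro add.subgroupI) (auto simp: subspace_of_def a_inv_def[symmetric])
  then have "additive_subgroup S M" by (rule additive_subgroupI)
  then show ?thesis
    by (rule abelian_subgroupI3) (rule abelian_group_axioms)
qed

lemma subspace_carrier: "subspace_of M S \<Longrightarrow> x \<in> S \<Longrightarrow> x \<in> carrier M"
  by (auto simp: subspace_of_def)

lemma subspace_complex_space: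
  assumes "subspace_of M S"
  shows "complex_space (M\<lparr>carrier := S\<rparr>)"
proof -
  have inv: "\<exists>y\<in>S. y \<oplus> x = \<zero>" if "x \<in> S" for x
  proof
    show "(-1) \<odot> x \<in> S" using assms that by (auto simp: subspace_of_def)
    show "(-1) \<odot> x \<oplus> x = \<zero>"
      using smult_minus_one[of x] l_neg[of x] subspace_carrier[OF assms that] by simp
  qed
  have [simp]: "x \<in> carrier M" if "x \<in> S" for x
    using subspace_carrier[OF assms that] .
  have [simp]: "\<zero> \<in> S" "\<And>x y. x \<in> S \<Longrightarrow> y \<in> S \<Longrightarrow> x \<oplus> y \<in> S" "\<And>c x. x \<in> S \<Longrightarrow> c \<odot> x \<in> S"
    using assms by (auto simp: subspace_of_def)
  show ?thesis
    by (intro complex_space.intro abelian_groupI complex_space_axioms.intro)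
       (simp_all add: inv, simp_all add: a_ac smult_add_left smult_add_right smult_smult)
qed

text \<open>The form in which cosets are compared below: two vectors have the same class as soon as one is the
other plus an element of the subspace.\<close>

lemma coset_eqI:
  assumes "subspace_of M S" "w \<in> S" "x \<in> carrier M" "y = w \<oplus> x"
  shows "S +> y = S +> x"
proof -
  interpret S: abelian_subgroup S M by (rule subspace_abelian_subgroup[OF assms(1)])
  have "y \<in> S +> x" using assms(2,4) unfolding a_r_coset_def' by auto
  then show ?thesis
    by (rule S.a_repr_independence'[OF _ assms(3), symmetric])
qed

lemma coset_self: "subspace_of M S \<Longrightarrow> x \<in> carrier M \<Longrightarrow> x \<in> S +> x"
  unfolding a_r_coset_def' subspace_of_def by (rule UN_I[of \<zero>]) auto

lemma coset_zero:
  assumes "subspace_of M S" shows "S +> \<zero> = S"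
proof -
  have "(\<Union>h\<in>S. {h \<oplus> \<zero>}) = (\<Union>h\<in>S. {h})"
    using subspace_carrier[OF assms] by (intro SUP_cong) simp_all
  then show ?thesis unfolding a_r_coset_def' by simp
qed

lemma coset_memE:
  assumes "y \<in> S +> x" obtains w where "w \<in> S" "y = w \<oplus> x"
  using assms unfolding a_r_coset_def' by auto

lemma coset_subset:
  assumes "subspace_of M S" "x \<in> carrier M" shows "S +> x \<subseteq> carrier M"
  unfolding a_r_coset_def' using subspace_carrier[OF assms(1)] assms(2) by auto

text \<open>The operations of a quotient are written as unions over all representatives. Along a coset of
\<^term>\<open>S\<close> the map \<^term>\<open>h\<close> moves only inside one coset of \<^term>\<open>S'\<close>, so all members of such a
union coincide. Two spaces and two subspaces are allowed because on the associated graded module an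
operator of degree \<open>j\<close> leads from one pair of filtration steps to another one.\<close>

lemma induced_coset:
  assumes "subspace_of M S" and M': "complex_space M'" and "subspace_of M' S'"
    and "\<And>x. x \<in> carrier M \<Longrightarrow> h x \<in> carrier M'"
    and "\<And>x y. x \<in> carrier M \<Longrightarrow> y \<in> carrier M \<Longrightarrow> h (x \<oplus> y) = h x \<oplus>\<^bsub>M'\<^esub> h y"
    and "\<And>x. x \<in> S \<Longrightarrow> h x \<in> S'"
    and "y \<in> carrier M"
  shows "(\<Union>x\<in>S +> y. S' +>\<^bsub>M'\<^esub> h x) = S' +>\<^bsub>M'\<^esub> h y"
proof -
  interpret M': complex_space M' by fact
  have "S' +>\<^bsub>M'\<^esub> h x = S' +>\<^bsub>M'\<^esub> h y" if "x \<in> S +> y" for x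
  proof -
    from that obtain w where w: "w \<in> S" "x = w \<oplus> y" by (rule coset_memE)
    then show ?thesis
      using M'.coset_eqI[OF assms(3) assms(6)[OF w(1)] assms(4)[OF assms(7)], of "h x"]
        assms(5)[of w y] assms(7) subspace_carrier[OF assms(1) w(1)] by simp
  qed
  then show ?thesis using coset_self[OF assms(1,7)] by blast
qed

lemma quot_carrier: "carrier (quot_space M S) = (\<lambda>x. S +> x) ` carrier M"
  by (auto simp: quot_space_def A_RCOSETS_def')

lemma quot_add:
  assumes "subspace_of M S" "x \<in> carrier M" "y \<in> carrier M"
  shows "(S +> x) \<oplus>\<^bsub>quot_space M S\<^esub> (S +> y) = S +> (x \<oplus> y)"
proof -
  interpret S: abelian_subgroup S M by (rule subspace_abelian_subgroup[OF assms(1)])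
  show ?thesis using S.a_rcos_sum[OF assms(2,3)] by (simp add: quot_space_def)
qed

lemma quot_smult:
  assumes "subspace_of M S" "x \<in> carrier M"
  shows "c \<odot>\<^bsub>quot_space M S\<^esub> (S +> x) = S +> (c \<odot> x)"
  using induced_coset[OF assms(1) complex_space_axioms assms(1), of "\<lambda>x. c \<odot> x" x] assms
  by (simp add: quot_space_def smult_add_right subspace_of_def)

lemma quot_zero: "\<zero>\<^bsub>quot_space M S\<^esub> = S"
  by (simp add: quot_space_def)

lemma quot_complex_space:
  assumes S: "subspace_of M S"
  shows "complex_space (quot_space M S)"
proof -
  let ?Q = "quot_space M S"
  have z: "\<zero>\<^bsub>?Q\<^esub> = S +> \<zero>" by (simp add: quot_zero coset_zero[OF S])
  note Q_simps = quot_add[OF S] quot_smult[OF S] z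
  have mem: "S +> a \<in> carrier ?Q" if "a \<in> carrier M" for a
    using that by (simp add: quot_carrier)
  have E: thesis if "C \<in> carrier ?Q" "\<And>a. a \<in> carrier M \<Longrightarrow> C = S +> a \<Longrightarrow> thesis" for C thesis
    using that by (auto simp: quot_carrier)
  show ?thesis
  proof (intro complex_space.intro abelian_groupI complex_space_axioms.intro)
    fix C assume "C \<in> carrier ?Q"
    then obtain a where a: "C = S +> a" "a \<in> carrier M" by (rule E)
    then have "(S +> (\<ominus> a)) \<oplus>\<^bsub>?Q\<^esub> C = \<zero>\<^bsub>?Q\<^esub>"
      by (simp add: Q_simps l_neg)
    then show "\<exists>D\<in>carrier ?Q. D \<oplus>\<^bsub>?Q\<^esub> C = \<zero>\<^bsub>?Q\<^esub>" using a mem by blast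
  qed ((elim E)?, simp add: Q_simps mem a_ac smult_add_left smult_add_right smult_smult)+
qed

end

text \<open>On cosets the induced isomorphism is taking images of sets, so that the isomorphism between
iterated quotients is an iterated image and no representatives have to be chosen.\<close>

lemma linear_iso_coset:
  assumes "complex_space M" "complex_space M'" "linear_iso f M M'" "subspace_of M S" "f ` S = S'"
    "x \<in> carrier M"
  shows "f ` (S +>\<^bsub>M\<^esub> x) = S' +>\<^bsub>M'\<^esub> f x"
proof -
  interpret M: complex_space M by fact
  have "f (w \<oplus>\<^bsub>M\<^esub> x) = f w \<oplus>\<^bsub>M'\<^esub> f x" if "w \<in> S" for w
    using assms(3,6) M.subspace_carrier[OF assms(4) that] by (simp add: linear_iso_def)
  then show ?thesis unfolding a_r_coset_def' assms(5)[symmetric] by (simp add: image_UN)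
qed

lemma linear_iso_subspace:
  assumes "linear_iso f M M'" "subspace_of M S"
  shows "linear_iso f (M\<lparr>carrier := S\<rparr>) (M'\<lparr>carrier := f ` S\<rparr>)"
  using assms by (auto simp: linear_iso_def subspace_of_def subset_eq bij_betw_def inj_on_def)

lemma linear_iso_quot:
  assumes "complex_space M" "complex_space M'" and f: "linear_iso f M M'"
    and S: "subspace_of M S" "f ` S = S'" "subspace_of M' S'"
  shows "linear_iso ((`) f) (quot_space M S) (quot_space M' S')"
proof -
  interpret M: complex_space M by fact
  interpret M': complex_space M' by fact
  have fc: "f x \<in> carrier M'" if "x \<in> carrier M" for x
    using f that by (auto simp: linear_iso_def bij_betw_def)
  note [simp] = linear_iso_coset[OF assms(1-3) S(1,2)] M.quot_add[OF S(1)] M'.quot_add[OF S(3)]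
    M.quot_smult[OF S(1)] M'.quot_smult[OF S(3)] M.quot_carrier M'.quot_carrier
  have "inj_on ((`) f) (carrier (quot_space M S))"
  proof (rule inj_onI)
    fix C D assume "C \<in> carrier (quot_space M S)" "D \<in> carrier (quot_space M S)" "f ` C = f ` D"
    moreover from this have "C \<subseteq> carrier M" "D \<subseteq> carrier M"
      using M.coset_subset[OF S(1)] by auto
    ultimately show "C = D"
      using f by (meson linear_iso_def bij_betw_def inj_on_image_eq_iff)
  qed
  moreover have "(`) f ` carrier (quot_space M S) = carrier (quot_space M' S')"
  proof -
    have "(`) f ` carrier (quot_space M S) = (\<lambda>x. S' +>\<^bsub>M'\<^esub> f x) ` carrier M"
      by (auto simp: image_image)
    also have "\<dots> = (\<lambda>x. S' +>\<^bsub>M'\<^esub> x) ` f ` carrier M" by (simp add: image_image)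
    also have "f ` carrier M = carrier M'" using f by (simp add: linear_iso_def bij_betw_def)
    finally show ?thesis by simp
  qed
  ultimately show ?thesis
    using f fc by (auto simp: linear_iso_def bij_betw_def)
qed

section \<open>Modules over the Lie algebra of matrices\<close>

locale lie_module = complex_space M for M :: "('n::finite glxy, 'a) lmodule" (structure) +
  assumes lact_closed [intro, simp]: "x \<in> carrier M \<Longrightarrow> lact M A x \<in> carrier M"
    and lact_add: "x \<in> carrier M \<Longrightarrow> y \<in> carrier M \<Longrightarrow> lact M A (x \<oplus> y) = lact M A x \<oplus> lact M A y"
    and lact_smult: "x \<in> carrier M \<Longrightarrow> lact M A (c \<odot> x) = c \<odot> lact M A x"
    and lact_add_left: "x \<in> carrier M \<Longrightarrow> lact M (A + B) x = lact M A x \<oplus> lact M B x"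
    and lact_scale_left: "x \<in> carrier M \<Longrightarrow> lact M (glxy_scale c A) x = c \<odot> lact M A x"
    and lact_bracket: "x \<in> carrier M \<Longrightarrow>
      lact M A (lact M B x) = lact M (glxy_bracket A B) x \<oplus> lact M B (lact M A x)"

text \<open>The value of a noncommutative polynomial in elements of the Lie algebra. The action of the
enveloping algebra is this value at a representative chosen by the quotient type.\<close>

definition free_eval :: "('g, 'a) lmodule \<Rightarrow> 'g free_algebra \<Rightarrow> 'a \<Rightarrow> 'a" where
  "free_eval M p v =
     (\<Oplus>\<^bsub>M\<^esub>w\<in>Poly_Mapping.keys p. Poly_Mapping.lookup p w \<odot>\<^bsub>M\<^esub> word_act (lact M) w v)"

text \<open>Adding one multiple of a generator at a time lets every fact on spans below be an induction with a
single step.\<close>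

inductive_set lspan :: "(complex, 'a, 'm) module_scheme \<Rightarrow> 'a set \<Rightarrow> 'a set" for M B where
  zero: "\<zero>\<^bsub>M\<^esub> \<in> lspan M B"
| step: "b \<in> B \<Longrightarrow> x \<in> lspan M B \<Longrightarrow> (c \<odot>\<^bsub>M\<^esub> b) \<oplus>\<^bsub>M\<^esub> x \<in> lspan M B"

text \<open>The spanning vectors of a filtration step: words of total degree at most \<^term>\<open>m\<close>, applied to
the generator.\<close>

definition filt_words :: "('n::finite glxy, 'a) lmodule \<Rightarrow> 'a \<Rightarrow> int \<Rightarrow> 'a set" where
  "filt_words M v m = {foldr (lact M) as v | as ms.
     list_all2 (\<lambda>a n. a \<in> glxy_filt n) as ms \<and> int (sum_list ms) \<le> m}"

lemma poly_mapping_add_induct [case_names zero single add]: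
  fixes p :: "'k \<Rightarrow>\<^sub>0 complex"
  assumes "P 0" "\<And>k c. P (Poly_Mapping.single k c)" "\<And>p q. P p \<Longrightarrow> P q \<Longrightarrow> P (p + q)"
  shows "P p"
proof -
  have "P (\<Sum>k\<in>A. Poly_Mapping.single k (Poly_Mapping.lookup p k))" if "finite A" for A
    using that by (induction A rule: finite_induct) (auto intro: assms)
  then show ?thesis by (subst poly_mapping_sum_single) simp
qed

subsection \<open>Linear spans\<close>

context complex_space
begin

lemma lspan_least: "B \<subseteq> S \<Longrightarrow> subspace_of M S \<Longrightarrow> lspan M B \<subseteq> S"
proof
  fix x assume S: "B \<subseteq> S" "subspace_of M S" and "x \<in> lspan M B"
  from this(3) show "x \<in> S"
    by induction (use S in \<open>auto simp: subspace_of_def\<close>)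
qed

lemma lspan_closed: "B \<subseteq> carrier M \<Longrightarrow> x \<in> lspan M B \<Longrightarrow> x \<in> carrier M"
  using lspan_least[of B "carrier M"] by (auto simp: subspace_of_def)

lemma lspan_subspace:
  assumes B: "B \<subseteq> carrier M" shows "subspace_of M (lspan M B)"
proof -
  note [simp] = lspan_closed[OF B] subsetD[OF B]
  have "x \<oplus> y \<in> lspan M B" if "x \<in> lspan M B" "y \<in> lspan M B" for x y
    using that(1)
  proof induction
    case (step b x c)
    then show ?case using lspan.step[of b B "x \<oplus> y" M c] that(2) by (simp add: a_assoc)
  qed (use that in \<open>simp add: lspan.zero\<close>)
  moreover have "d \<odot> x \<in> lspan M B" if "x \<in> lspan M B" for d x
    using that
  proof induction
    case (step b x c)
    then show ?case using lspan.step[of b B "d \<odot> x" M "d * c"]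
      by (simp add: smult_add_right smult_smult)
  qed (simp add: lspan.zero)
  ultimately show ?thesis
    using lspan_closed[OF B] by (auto simp: subspace_of_def lspan.zero)
qed

end

lemma lspan_mono: "B \<subseteq> C \<Longrightarrow> lspan M B \<subseteq> lspan M C"
proof
  fix x assume "B \<subseteq> C" "x \<in> lspan M B"
  from this(2) show "x \<in> lspan M C"
    by induction (use \<open>B \<subseteq> C\<close> in \<open>auto intro: lspan.intros\<close>)
qed

lemma lspan_cong:
  assumes "zero M = zero M'" "add M = add M'" "smult M = smult M'"
  shows "lspan M B = lspan M' B"
proof (intro equalityI subsetI)
  fix x assume "x \<in> lspan M B" then show "x \<in> lspan M' B"
  proof induction
    case (step b x c) then show ?case using lspan.step[of b B x M' c] assms by simp
  qed (simp add: assms lspan.zero)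
next
  fix x assume "x \<in> lspan M' B" then show "x \<in> lspan M B"
  proof induction
    case (step b x c) then show ?case using lspan.step[of b B x M c] assms by simp
  qed (simp add: assms[symmetric] lspan.zero)
qed

lemma linear_iso_lspan:
  assumes "complex_space M" "complex_space M'" "linear_iso f M M'" "B \<subseteq> carrier M"
  shows "f ` lspan M B = lspan M' (f ` B)"
proof -
  interpret M: complex_space M by fact
  interpret M': complex_space M' by fact
  note cl = M.lspan_closed[OF assms(4)] subsetD[OF assms(4)]
  have f: "f ((c \<odot>\<^bsub>M\<^esub> b) \<oplus>\<^bsub>M\<^esub> x) = (c \<odot>\<^bsub>M'\<^esub> f b) \<oplus>\<^bsub>M'\<^esub> f x" if "b \<in> B" "x \<in> lspan M B" for b c x
    using assms(3) cl that by (simp add: linear_iso_def)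
  show ?thesis
  proof (intro equalityI subsetI)
    fix y assume "y \<in> f ` lspan M B"
    then obtain x where "x \<in> lspan M B" "y = f x" by blast
    moreover from this(1) have "f x \<in> lspan M' (f ` B)"
      by induction (auto simp: linear_iso_zero[OF assms(1-3)] f intro!: lspan.intros)
    ultimately show "y \<in> lspan M' (f ` B)" by simp
  next
    fix y assume "y \<in> lspan M' (f ` B)"
    then show "y \<in> f ` lspan M B"
    proof induction
      case zero
      then show ?case using linear_iso_zero[OF assms(1-3)] lspan.zero by (metis imageI)
    next
      case (step b y c)
      then obtain b' x where "b = f b'" "b' \<in> B" "y = f x" "x \<in> lspan M B" by blast
      then show ?case using f lspan.step[of b' B x M c] by (metis imageI)
    qed
  qed
qed

subsection \<open>The action of the enveloping algebra\<close>

context lie_module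
begin

lemma foldr_lact_closed [simp]: "x \<in> carrier M \<Longrightarrow> foldr (lact M) as x \<in> carrier M"
  by (induction as) auto

lemma word_act_closed [simp]: "x \<in> carrier M \<Longrightarrow> word_act (lact M) w x \<in> carrier M"
  by (simp add: word_act_def)

lemma word_act_add:
  "x \<in> carrier M \<Longrightarrow> y \<in> carrier M \<Longrightarrow>
   word_act (lact M) w (x \<oplus> y) = word_act (lact M) w x \<oplus> word_act (lact M) w y"
proof -
  assume xy: "x \<in> carrier M" "y \<in> carrier M"
  have "foldr (lact M) as (x \<oplus> y) = foldr (lact M) as x \<oplus> foldr (lact M) as y" for as
    by (induction as) (simp_all add: xy lact_add)
  then show ?thesis by (simp add: word_act_def)
qed

lemma word_act_smult:
  "x \<in> carrier M \<Longrightarrow> word_act (lact M) w (c \<odot> x) = c \<odot> word_act (lact M) w x"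
proof -
  assume x: "x \<in> carrier M"
  have "foldr (lact M) as (c \<odot> x) = c \<odot> foldr (lact M) as x" for as
    by (induction as) (simp_all add: x lact_smult)
  then show ?thesis by (simp add: word_act_def)
qed

lemma word_act_plus: "word_act (lact M) (w + w') x = word_act (lact M) w (word_act (lact M) w' x)"
  by (simp add: word_act_def plus_word_def)

lemma free_eval_superset:
  assumes "finite S" "Poly_Mapping.keys p \<subseteq> S" "x \<in> carrier M"
  shows "free_eval M p x = (\<Oplus>w\<in>S. Poly_Mapping.lookup p w \<odot> word_act (lact M) w x)"
  unfolding free_eval_def
  by (rule add.finprod_mono_neutral_cong_left) (use assms in \<open>auto simp: in_keys_iff\<close>)

lemma free_eval_closed [simp]: "x \<in> carrier M \<Longrightarrow> free_eval M p x \<in> carrier M"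
  unfolding free_eval_def by (rule finsum_closed) auto

lemma free_eval_add:
  assumes x: "x \<in> carrier M"
  shows "free_eval M (p + q) x = free_eval M p x \<oplus> free_eval M q x"
proof -
  let ?S = "Poly_Mapping.keys p \<union> Poly_Mapping.keys q"
  have "free_eval M (p + q) x =
      (\<Oplus>w\<in>?S. (Poly_Mapping.lookup p w \<odot> word_act (lact M) w x) \<oplus>
        (Poly_Mapping.lookup q w \<odot> word_act (lact M) w x))"
    using x by (subst free_eval_superset[of ?S])
      (auto simp: lookup_add smult_add_left keys_add intro!: finsum_cong')
  also have "\<dots> = (\<Oplus>w\<in>?S. Poly_Mapping.lookup p w \<odot> word_act (lact M) w x) \<oplus>
      (\<Oplus>w\<in>?S. Poly_Mapping.lookup q w \<odot> word_act (lact M) w x)"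
    by (rule finsum_addf) (use x in auto)
  also have "\<dots> = free_eval M p x \<oplus> free_eval M q x"
    by (subst (1 2) free_eval_superset[of ?S]) (use x in auto)
  finally show ?thesis .
qed

lemma free_eval_zero [simp]: "free_eval M 0 x = \<zero>"
  by (simp add: free_eval_def)

lemma free_eval_single [simp]:
  "x \<in> carrier M \<Longrightarrow> free_eval M (Poly_Mapping.single w c) x = c \<odot> word_act (lact M) w x"
  by (subst free_eval_superset[of "{w}"]) simp_all

lemma free_eval_gen [simp]: "x \<in> carrier M \<Longrightarrow> free_eval M (gen A) x = lact M A x"
  by (simp add: gen_def word_act_def)

lemma free_eval_zero_right [simp]: "free_eval M p \<zero> = \<zero>"
  by (induction p rule: poly_mapping_add_induct)
     (use word_act_smult[of \<zero> _ 0] in \<open>simp_all add: free_eval_add\<close>)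

text \<open>Both sides are additive in \<^term>\<open>p\<close> and in \<^term>\<open>q\<close>, which leaves monomials, where the
claim is that words act by composition.\<close>

lemma free_eval_mult:
  assumes x: "x \<in> carrier M"
  shows "free_eval M (p * q) x = free_eval M p (free_eval M q x)"
proof (induction p rule: poly_mapping_add_induct)
  case (single w c)
  show ?case using x
    by (induction q rule: poly_mapping_add_induct)
       (use word_act_smult[of \<zero> _ 0] in \<open>simp_all add: mult_single word_act_plus word_act_smult
          smult_smult distrib_left free_eval_add word_act_add smult_add_right\<close>)
qed (simp_all add: distrib_right free_eval_add x)

lemma free_eval_minus:
  assumes "x \<in> carrier M"
  shows "free_eval M (p - q) x = free_eval M p x \<ominus> free_eval M q x"
proof -
  have "free_eval M (p - q) x \<oplus> free_eval M q x = free_eval M p x"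
    using free_eval_add[OF assms, of "p - q" q] by simp
  then show ?thesis using assms by (metis minus_eq a_assoc a_inv_closed free_eval_closed r_neg r_zero)
qed

text \<open>This is where the axioms of a Lie algebra action are used: each of the three families of defining
relations of the enveloping algebra is one of them.\<close>

lemma free_eval_relation:
  assumes "s \<in> env_relations" "x \<in> carrier M"
  shows "free_eval M s x = \<zero>"
proof -
  have **: "a \<oplus> b \<ominus> b \<ominus> a = \<zero>" if "a \<in> carrier M" "b \<in> carrier M" for a b
    using that by (simp add: minus_eq a_assoc r_neg r_neg2 r_neg1)
  have *: "a \<oplus> b \<ominus> a \<ominus> b = \<zero>" if "a \<in> carrier M" "b \<in> carrier M" for a b
    using **[OF that(2,1)] a_comm[OF that] by simp
  note simps = free_eval_minus free_eval_mult assms(2)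
  have bracket: "free_eval M (gen A * gen B - gen B * gen A - gen (glxy_bracket A B)) x = \<zero>" for A B
  proof -
    have "lact M A (lact M B x) \<ominus> lact M B (lact M A x) \<ominus> lact M (glxy_bracket A B) x = \<zero>"
      unfolding lact_bracket[OF assms(2), of A B] by (rule **) (simp_all add: assms(2))
    then show ?thesis by (simp add: simps)
  qed
  have add: "free_eval M (gen (A + B) - gen A - gen B) x = \<zero>" for A B
    by (simp add: simps lact_add_left *)
  have scale: "free_eval M (gen (glxy_scale c A) - Poly_Mapping.single 0 c * gen A) x = \<zero>" for c A
    by (simp add: simps lact_scale_left word_act_def zero_word_def minus_eq r_neg)
  from assms(1) consider A B where "s = gen (A + B) - gen A - gen B"
    | c A where "s = gen (glxy_scale c A) - Poly_Mapping.single 0 c * gen A"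
    | A B where "s = gen A * gen B - gen B * gen A - gen (glxy_bracket A B)"
    unfolding env_relations_def by blast
  then show ?thesis by cases (simp_all only: add scale bracket)
qed

text \<open>For a generator \<open>a s b\<close> of the ideal, \<open>s\<close> already kills the vector \<open>b x\<close>.\<close>

lemma free_eval_ideal:
  assumes "p \<in> two_sided_ideal env_relations" "x \<in> carrier M"
  shows "free_eval M p x = \<zero>"
  using assms(1)
proof induction
  case (mult s a b)
  then show ?case
    using assms(2) free_eval_relation[of s "free_eval M b x"] by (simp add: free_eval_mult)
qed (simp_all add: free_eval_add assms(2))

text \<open>Two representatives differ by an element of the ideal, hence act in the same way. From here on the
choice of representatives in the definition of the action does not matter.\<close>

lemma env_act_abs:
  assumes "x \<in> carrier M"
  shows "env_act M (abs_env p) x = free_eval M p x"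
proof -
  have "ideal_cong env_relations (rep_env (abs_env p)) p"
    by (rule Quotient3_rep_abs[OF Quotient3_env]) (rule equivp_reflp[OF equivp_ideal_cong])
  then have "free_eval M (rep_env (abs_env p) - p) x = \<zero>"
    using free_eval_ideal[OF _ assms] unfolding ideal_cong_def by blast
  moreover have "free_eval M (rep_env (abs_env p)) x
      = free_eval M (rep_env (abs_env p) - p) x \<oplus> free_eval M p x"
    using free_eval_add[OF assms, of "rep_env (abs_env p) - p" p] by simp
  moreover have "env_act M (abs_env p) x = free_eval M (rep_env (abs_env p)) x"
    by (simp add: env_act_def free_eval_def Let_def)
  ultimately show ?thesis using assms by simp
qed

lemma env_act_add:
  assumes "x \<in> carrier M"
  shows "env_act M (u + u') x = env_act M u x \<oplus> env_act M u' x"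
proof -
  obtain p p' where "u = abs_env p" "u' = abs_env p'" by (metis Quotient3_abs_rep[OF Quotient3_env])
  then show ?thesis
    by (simp add: plus_env.abs_eq env_act_abs assms free_eval_add)
qed

lemma env_act_zero: "x \<in> carrier M \<Longrightarrow> env_act M 0 x = \<zero>"
  unfolding zero_env_def by (simp add: env_act_abs)

lemma env_act_scale:
  assumes "x \<in> carrier M"
  shows "env_act M (env_scale c u) x = c \<odot> env_act M u x"
proof -
  obtain p where "u = abs_env p" by (metis Quotient3_abs_rep[OF Quotient3_env])
  then show ?thesis
    by (simp add: env_scale.abs_eq env_act_abs assms free_eval_mult word_act_def zero_word_def)
qed

lemma env_act_env_of_mult:
  assumes "x \<in> carrier M"
  shows "env_act M (env_of A * u) x = lact M A (env_act M u x)"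
proof -
  obtain p where "u = abs_env p" by (metis Quotient3_abs_rep[OF Quotient3_env])
  then show ?thesis
    by (simp add: env_of_def times_env.abs_eq env_act_abs assms free_eval_mult)
qed

lemma env_act_one: "x \<in> carrier M \<Longrightarrow> env_act M 1 x = x"
  unfolding one_env_def by (simp add: env_act_abs word_act_def zero_word_def flip: single_one)

lemma env_act_closed: "x \<in> carrier M \<Longrightarrow> env_act M u x \<in> carrier M"
  by (metis Quotient3_abs_rep[OF Quotient3_env] env_act_abs free_eval_closed)

lemma env_act_prod_list:
  "x \<in> carrier M \<Longrightarrow> env_act M (prod_list (map env_of as)) x = foldr (lact M) as x"
  by (induction as) (simp_all add: env_act_one env_act_env_of_mult)

text \<open>Together with the value on products of Lie algebra elements this describes each filtration step as
a span of vectors of the module; the enveloping algebra does not occur in the later arguments.\<close>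

lemma env_act_span:
  assumes "x \<in> carrier M"
  shows "(\<lambda>u. env_act M u x) ` env.span G = lspan M ((\<lambda>u. env_act M u x) ` G)" (is "?l = ?r")
proof (intro equalityI subsetI)
  fix y assume "y \<in> ?l"
  then obtain u where "u \<in> env.span G" "y = env_act M u x" by blast
  moreover from this(1) have "env_act M u x \<in> ?r"
    by (induction rule: env.span_induct_alt)
       (auto simp: env_act_zero env_act_add env_act_scale assms intro!: lspan.intros)
  ultimately show "y \<in> ?r" by simp
next
  fix y assume "y \<in> ?r"
  then show "y \<in> ?l"
  proof induction
    case zero
    show ?case using env_act_zero[OF assms] env.span_zero[of G] by (metis imageI)
  next
    case (step b y c)
    then obtain g u where "g \<in> G" "b = env_act M g x" "u \<in> env.span G" "y = env_act M u x" by blast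
    then have "env_scale c g + u \<in> env.span G"
      "(c \<odot> b) \<oplus> y = env_act M (env_scale c g + u) x"
      by (simp_all add: env.span_add env.span_scale env.span_base env_act_add env_act_scale assms)
    then show ?case by blast
  qed
qed

subsection \<open>The filtration\<close>

lemma filt_eq_lspan:
  assumes "v \<in> carrier M" shows "filt M v m = lspan M (filt_words M v m)"
proof -
  have "(\<lambda>u. env_act M u v) ` {prod_list (map env_of as) | as ms.
      list_all2 (\<lambda>a n. a \<in> glxy_filt n) as ms \<and> int (sum_list ms) \<le> m} = filt_words M v m"
    unfolding filt_words_def
    by (auto simp: env_act_prod_list[OF assms] image_iff) (metis env_act_prod_list[OF assms])
  then show ?thesis unfolding filt_def env_filt_def env_act_span[OF assms] by simp
qed

lemma filt_words_carrier: "v \<in> carrier M \<Longrightarrow> filt_words M v m \<subseteq> carrier M"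
  by (auto simp: filt_words_def)

lemma filt_subspace: "v \<in> carrier M \<Longrightarrow> subspace_of M (filt M v m)"
  by (simp add: filt_eq_lspan lspan_subspace filt_words_carrier)

lemma filt_mono:
  assumes "v \<in> carrier M" "m \<le> m'" shows "filt M v m \<subseteq> filt M v m'"
  unfolding filt_eq_lspan[OF assms(1)]
  by (rule lspan_mono) (use assms(2) in \<open>fastforce simp: filt_words_def\<close>)

text \<open>Applying \<^term>\<open>A\<close> prepends one letter of degree \<^term>\<open>j\<close> to each word.\<close>

lemma filt_lact:
  assumes v: "v \<in> carrier M" and A: "A \<in> glxy_filt j" and x: "x \<in> filt M v m"
  shows "lact M A x \<in> filt M v (m + int j)"
proof -
  note cl = lspan_closed[OF filt_words_carrier[OF v]] subsetD[OF filt_words_carrier[OF v]]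
  have w: "lact M A b \<in> filt_words M v (m + int j)" if b: "b \<in> filt_words M v m" for b
  proof -
    from b obtain as ms where "b = foldr (lact M) as v"
      "list_all2 (\<lambda>a n. a \<in> glxy_filt n) as ms" "int (sum_list ms) \<le> m"
      unfolding filt_words_def by blast
    then have "lact M A b = foldr (lact M) (A # as) v"
      "list_all2 (\<lambda>a n. a \<in> glxy_filt n) (A # as) (j # ms)" "int (sum_list (j # ms)) \<le> m + int j"
      using A by simp_all
    then show ?thesis unfolding filt_words_def by blast
  qed
  have "x \<in> lspan M (filt_words M v m)" using x by (simp add: filt_eq_lspan v)
  then have "lact M A x \<in> lspan M (filt_words M v (m + int j))"
  proof induction
    case zero
    show ?case using lact_smult[of \<zero> A 0] by (simp add: lspan.zero)
  next
    case (step b x c)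
    then show ?case using w cl by (auto simp: lact_add lact_smult intro!: lspan.step)
  qed
  then show ?thesis by (simp add: filt_eq_lspan v)
qed

lemma sub_lie_module:
  assumes "subspace_of M S" "\<And>A x. x \<in> S \<Longrightarrow> lact M A x \<in> S"
  shows "lie_module (M\<lparr>carrier := S\<rparr>)"
proof -
  have "x \<in> carrier M" if "x \<in> S" for x using subspace_carrier[OF assms(1) that] .
  then show ?thesis
    by (intro lie_module.intro lie_module_axioms.intro subspace_complex_space[OF assms(1)])
       (simp_all add: assms(2) lact_add lact_smult lact_add_left lact_scale_left lact_bracket[symmetric])
qed

lemma cyclic_lie_module:
  assumes v: "v \<in> carrier M"
  shows "lie_module (cyclic M v)"
  unfolding cyclic_def
proof (rule sub_lie_module)
  show "subspace_of M (range (\<lambda>u. env_act M u v))"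
    unfolding subspace_of_def
    using v env_act_zero[OF v] env_act_add[OF v] env_act_scale[OF v]
    by (auto simp: env_act_closed image_iff) metis+
  show "lact M A x \<in> range (\<lambda>u. env_act M u v)" if "x \<in> range (\<lambda>u. env_act M u v)" for A x
    using that env_act_env_of_mult[OF v] by (auto simp: image_iff) metis
qed

lemma cyclic_generator:
  assumes v: "v \<in> carrier M" shows "v \<in> carrier (cyclic M v)"
  unfolding cyclic_def using env_act_one[OF v] by (simp add: image_iff) metis

lemma filt_cyclic:
  assumes v: "v \<in> carrier M" shows "filt (cyclic M v) v m = filt M v m"
proof -
  interpret C: lie_module "cyclic M v" by (rule cyclic_lie_module[OF v])
  have "filt_words (cyclic M v) v m = filt_words M v m"
    by (simp add: filt_words_def cyclic_def)
  moreover have "lspan (cyclic M v) B = lspan M B" for B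
    by (rule lspan_cong) (simp_all add: cyclic_def)
  ultimately show ?thesis
    by (simp add: C.filt_eq_lspan[OF cyclic_generator[OF v]] filt_eq_lspan[OF v])
qed

text \<open>The associated graded module sees the operations and the filtration, but not the carrier of the
ambient module. So the exterior power can take the place of its cyclic submodule.\<close>

lemma gr_module_cyclic:
  assumes v: "v \<in> carrier M" shows "gr_module (cyclic M v) v = gr_module M v"
proof -
  have p: "gr_piece (cyclic M v) v = gr_piece M v"
    by (rule ext) (simp add: gr_piece_def filt_cyclic[OF v], simp add: cyclic_def)
  have c: "S +>\<^bsub>cyclic M v\<^esub> x = S +>\<^bsub>M\<^esub> x" for S x
    by (simp add: a_r_coset_def' cyclic_def)
  have l: "lact (cyclic M v) = lact M" by (simp add: cyclic_def)
  show ?thesis by (simp add: gr_module_def p c l filt_cyclic[OF v])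
qed

end

section \<open>Isomorphisms of associated graded modules\<close>

text \<open>The classes of \<^term>\<open>A\<close> and \<^term>\<open>B\<close> in degree \<^term>\<open>n\<close> of the associated graded Lie algebra
agree. In degree 0 nothing lies below, so equality is required.\<close>

definition same_symbol :: "nat \<Rightarrow> 'n::finite glxy \<Rightarrow> 'n glxy \<Rightarrow> bool" where
  "same_symbol n A B \<longleftrightarrow> A \<in> glxy_filt n \<and> B \<in> glxy_filt n \<and>
     (if n = 0 then A = B else B - A \<in> glxy_filt (n - 1))"

definition intertwines ::
  "('a \<Rightarrow> 'b) \<Rightarrow> ('g, 'a) lmodule \<Rightarrow> ('g, 'b) lmodule \<Rightarrow> 'g \<Rightarrow> 'g \<Rightarrow> bool" where
  "intertwines f M M' A B \<longleftrightarrow> (\<forall>x\<in>carrier M. f (lact M A x) = lact M' B (f x))"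

text \<open>A linear isomorphism that commutes with the Lie algebra up to terms of lower degree. Neither a map
of the Lie algebra nor one of its enveloping algebra is asked for, only partners for single
elements; words can be translated letter by letter, and the last clause makes this possible in
the other direction too.\<close>

definition symbol_iso ::
  "('a \<Rightarrow> 'b) \<Rightarrow> ('n::finite glxy, 'a) lmodule \<Rightarrow> ('n glxy, 'b) lmodule \<Rightarrow> bool" where
  "symbol_iso f M M' \<longleftrightarrow> linear_iso f M M' \<and>
     (\<forall>n. \<forall>A\<in>glxy_filt n. \<exists>B. same_symbol n A B \<and> intertwines f M M' A B) \<and>
     (\<forall>n. \<forall>B\<in>glxy_filt n. \<exists>A. same_symbol n A B \<and> intertwines f M M' A B)"

lemma symbol_lift_filt: "symbol_lift j g \<in> glxy_filt j"
proof -
  have "xyX ^ i * xyY ^ j \<in> xy_filt j" for i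
    unfolding xy_filt_def by (rule xy.span_base) auto
  then show ?thesis
    unfolding glxy_filt_def symbol_lift_def Let_def
    by (auto simp: xy_filt_def intro!: xy.span_sum xy.span_scale)
qed

lemma coset_carrier_update [simp]: "S +>\<^bsub>M\<lparr>carrier := F\<rparr>\<^esub> x = S +>\<^bsub>M\<^esub> x"
  by (simp add: a_r_coset_def')

lemma subspace_of_carrier_update:
  "subspace_of M S \<Longrightarrow> S \<subseteq> F \<Longrightarrow> subspace_of (M\<lparr>carrier := F\<rparr>) S"
  by (auto simp: subspace_of_def)

text \<open>Preserving zero makes the supports of corresponding families equal, so that finiteness of the
support carries over.\<close>

lemma direct_sum_bij:
  assumes "\<And>m. bij_betw (h m) (carrier (Q m)) (carrier (Q' m))"
    and "\<And>m. \<zero>\<^bsub>Q m\<^esub> \<in> carrier (Q m)" "\<And>m. h m \<zero>\<^bsub>Q m\<^esub> = \<zero>\<^bsub>Q' m\<^esub>"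
  shows "bij_betw (\<lambda>w m. h m (w m)) (carrier (direct_sum Q)) (carrier (direct_sum Q'))"
proof (rule bij_betw_imageI)
  have zero_iff: "h m x = \<zero>\<^bsub>Q' m\<^esub> \<longleftrightarrow> x = \<zero>\<^bsub>Q m\<^esub>" if "x \<in> carrier (Q m)" for m x
    using assms that by (metis bij_betw_inv_into_left)
  have mem: "(\<lambda>m. h m (w m)) \<in> carrier (direct_sum Q') \<longleftrightarrow> w \<in> carrier (direct_sum Q)"
    if "\<forall>m. w m \<in> carrier (Q m)" for w
    using that assms(1) zero_iff by (auto simp: direct_sum_def bij_betw_def)
  show "inj_on (\<lambda>w m. h m (w m)) (carrier (direct_sum Q))"
  proof (rule inj_onI, rule ext)
    fix w w' m
    assume w: "w \<in> carrier (direct_sum Q)" "w' \<in> carrier (direct_sum Q)"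
      and "(\<lambda>m. h m (w m)) = (\<lambda>m. h m (w' m))"
    from this(3) have "h m (w m) = h m (w' m)" by (rule fun_cong)
    then show "w m = w' m"
      using assms(1)[of m] w by (auto simp: direct_sum_def bij_betw_def inj_on_def)
  qed
  show "(\<lambda>w m. h m (w m)) ` carrier (direct_sum Q) = carrier (direct_sum Q')"
  proof (intro equalityI subsetI)
    fix z assume "z \<in> (\<lambda>w m. h m (w m)) ` carrier (direct_sum Q)"
    then obtain w where "w \<in> carrier (direct_sum Q)" "z = (\<lambda>m. h m (w m))" by blast
    then show "z \<in> carrier (direct_sum Q')"
      using mem[of w] by (simp add: direct_sum_def)
  next
    fix z assume z: "z \<in> carrier (direct_sum Q')"
    define w where "w m = inv_into (carrier (Q m)) (h m) (z m)" for m
    have "z m \<in> h m ` carrier (Q m)" for m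
      using z assms(1)[of m] by (simp add: direct_sum_def bij_betw_def)
    then have "\<forall>m. w m \<in> carrier (Q m)" "z = (\<lambda>m. h m (w m))"
      by (auto simp: w_def inv_into_into f_inv_into_f)
    then show "z \<in> (\<lambda>w m. h m (w m)) ` carrier (direct_sum Q)" using mem[of w] z by blast
  qed
qed

locale graded_transport =
  M: lie_module M + M': lie_module M'
  for M :: "('n::finite glxy, 'a) lmodule" and M' :: "('n glxy, 'b) lmodule" +
  fixes f v
  assumes iso: "symbol_iso f M M'" and v: "v \<in> carrier M"
begin

lemma linear: "linear_iso f M M'"
  using iso by (simp add: symbol_iso_def)

lemma f_closed [simp]: "x \<in> carrier M \<Longrightarrow> f x \<in> carrier M'"
  using linear by (auto simp: linear_iso_def bij_betw_def)

lemmas v' = f_closed[OF v]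

text \<open>Each letter of a word is replaced by its partner, which has the same degree.\<close>

lemma f_words: "f ` filt_words M v m = filt_words M' (f v) m"
proof (intro equalityI subsetI)
  fix y assume "y \<in> f ` filt_words M v m"
  then obtain as ms where as: "y = f (foldr (lact M) as v)"
    "list_all2 (\<lambda>a n. a \<in> glxy_filt n) as ms" "int (sum_list ms) \<le> m"
    unfolding filt_words_def by blast
  from as(2) have "\<exists>bs. list_all2 (\<lambda>a n. a \<in> glxy_filt n) bs ms \<and>
      f (foldr (lact M) as v) = foldr (lact M') bs (f v)"
  proof induction
    case (Cons a as n ms)
    then obtain bs where bs: "list_all2 (\<lambda>a n. a \<in> glxy_filt n) bs ms"
      "f (foldr (lact M) as v) = foldr (lact M') bs (f v)" by blast
    from Cons(1) obtain b where "same_symbol n a b" "intertwines f M M' a b"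
      using iso unfolding symbol_iso_def by blast
    then have "list_all2 (\<lambda>a n. a \<in> glxy_filt n) (b # bs) (n # ms)"
      "f (foldr (lact M) (a # as) v) = foldr (lact M') (b # bs) (f v)"
      using bs v by (simp_all add: same_symbol_def intertwines_def)
    then show ?case by blast
  qed (rule exI[of _ "[]"], simp)
  then show "y \<in> filt_words M' (f v) m"
    using as unfolding filt_words_def by auto
next
  fix y assume "y \<in> filt_words M' (f v) m"
  then obtain bs ms where bs: "y = foldr (lact M') bs (f v)"
    "list_all2 (\<lambda>a n. a \<in> glxy_filt n) bs ms" "int (sum_list ms) \<le> m"
    unfolding filt_words_def by blast
  from bs(2) have "\<exists>as. list_all2 (\<lambda>a n. a \<in> glxy_filt n) as ms \<and>
      f (foldr (lact M) as v) = foldr (lact M') bs (f v)"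
  proof induction
    case (Cons b bs n ms)
    then obtain as where as: "list_all2 (\<lambda>a n. a \<in> glxy_filt n) as ms"
      "f (foldr (lact M) as v) = foldr (lact M') bs (f v)" by blast
    from Cons(1) obtain a where "same_symbol n a b" "intertwines f M M' a b"
      using iso unfolding symbol_iso_def by blast
    then have "list_all2 (\<lambda>a n. a \<in> glxy_filt n) (a # as) (n # ms)"
      "f (foldr (lact M) (a # as) v) = foldr (lact M') (b # bs) (f v)"
      using as v by (simp_all add: same_symbol_def intertwines_def)
    then show ?case by blast
  qed (rule exI[of _ "[]"], simp)
  then obtain as where "list_all2 (\<lambda>a n. a \<in> glxy_filt n) as ms"
    "f (foldr (lact M) as v) = foldr (lact M') bs (f v)" by blast
  moreover from this(1) bs(3) have "foldr (lact M) as v \<in> filt_words M v m"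
    unfolding filt_words_def by blast
  ultimately show "y \<in> f ` filt_words M v m"
    unfolding bs(1) by (metis imageI)
qed

lemma f_filt: "f ` filt M v m = filt M' (f v) m"
  unfolding M.filt_eq_lspan[OF v] M'.filt_eq_lspan[OF v']
  by (subst linear_iso_lspan[OF M.complex_space_axioms M'.complex_space_axioms linear])
     (simp_all add: M.filt_words_carrier v f_words)

lemma piece_subspace: "subspace_of (M\<lparr>carrier := filt M v m\<rparr>) (filt M v (m - 1))"
  by (intro subspace_of_carrier_update M.filt_subspace M.filt_mono v) simp

lemma piece_iso: "linear_iso ((`) f) (gr_piece M v m) (gr_piece M' (f v) m)"
  unfolding gr_piece_def
proof (rule linear_iso_quot)
  show "linear_iso f (M\<lparr>carrier := filt M v (int m)\<rparr>) (M'\<lparr>carrier := filt M' (f v) (int m)\<rparr>)"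
    using linear_iso_subspace[OF linear M.filt_subspace[OF v]] by (simp add: f_filt)
  show "subspace_of (M'\<lparr>carrier := filt M' (f v) (int m)\<rparr>) (filt M' (f v) (int m - 1))"
    by (intro subspace_of_carrier_update M'.filt_subspace M'.filt_mono v') simp
qed (intro M.subspace_complex_space M'.subspace_complex_space M.filt_subspace M'.filt_subspace
    v v' piece_subspace f_filt)+

lemma piece_space: "complex_space (gr_piece M v m)"
  unfolding gr_piece_def
  by (intro complex_space.quot_complex_space M.subspace_complex_space M.filt_subspace v
      piece_subspace)

lemma piece_carrier:
  "carrier (gr_piece M v m) = (\<lambda>x. filt M v (int m - 1) +>\<^bsub>M\<^esub> x) ` filt M v (int m)"
  unfolding gr_piece_def
  by (subst complex_space.quot_carrier) (simp_all add: M.subspace_complex_space M.filt_subspace v)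

text \<open>A symbol of degree \<^term>\<open>j\<close> takes a class \<^term>\<open>C\<close> of degree \<^term>\<open>m - j\<close> to one of degree
\<^term>\<open>m\<close>. The map \<^term>\<open>f\<close> turns the action of \<^term>\<open>s\<close> into that of a partner
\<open>B\<close>. The error \<open>B - s\<close> has degree at most \<^term>\<open>j - 1\<close> and sends the class into the
filtration step \<^term>\<open>m - 1\<close>, where it vanishes in the quotient.\<close>

lemma action_component:
  fixes g :: "'n gxy"
  assumes C: "C \<in> carrier (gr_piece M v (m - j))" and "j \<le> m"
  defines "s \<equiv> symbol_lift j g"
  defines "R \<equiv> (\<Union>x\<in>C. filt M v (int m - 1) +>\<^bsub>M\<^esub> lact M s x)"
  shows "R \<in> carrier (gr_piece M v m)"
    and "f ` R = (\<Union>x\<in>f ` C. filt M' (f v) (int m - 1) +>\<^bsub>M'\<^esub> lact M' s x)"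
proof -
  have s: "s \<in> glxy_filt j" unfolding s_def by (rule symbol_lift_filt)
  from C obtain y where y: "y \<in> filt M v (int (m - j))" "C = filt M v (int (m - j) - 1) +>\<^bsub>M\<^esub> y"
    unfolding piece_carrier by blast
  have yc: "y \<in> carrier M" using M.subspace_carrier[OF M.filt_subspace[OF v] y(1)] .
  have fy: "f y \<in> filt M' (f v) (int (m - j))" using y(1) f_filt by blast
  have deg: "int (m - j) - 1 + int j = int m - 1" "int (m - j) + int j = int m" using \<open>j \<le> m\<close> by auto
  have R: "R = filt M v (int m - 1) +>\<^bsub>M\<^esub> lact M s y"
    unfolding R_def y(2)
    by (rule M.induced_coset[OF M.filt_subspace[OF v] M.complex_space_axioms M.filt_subspace[OF v]])
       (use M.filt_lact[OF v s, of _ "int (m - j) - 1"] yc in \<open>auto simp: deg M.lact_add\<close>)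
  show "R \<in> carrier (gr_piece M v m)"
    unfolding R piece_carrier using M.filt_lact[OF v s y(1)] by (simp add: deg)
  have fC: "f ` C = filt M' (f v) (int (m - j) - 1) +>\<^bsub>M'\<^esub> f y"
    unfolding y(2)
    by (rule linear_iso_coset[OF M.complex_space_axioms M'.complex_space_axioms linear
        M.filt_subspace[OF v] f_filt yc])
  have R': "(\<Union>x\<in>f ` C. filt M' (f v) (int m - 1) +>\<^bsub>M'\<^esub> lact M' s x)
      = filt M' (f v) (int m - 1) +>\<^bsub>M'\<^esub> lact M' s (f y)"
    unfolding fC
    by (rule M'.induced_coset[OF M'.filt_subspace[OF v'] M'.complex_space_axioms M'.filt_subspace[OF v']])
       (use M'.filt_lact[OF v' s, of _ "int (m - j) - 1"] yc in \<open>auto simp: deg M'.lact_add\<close>)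
  obtain B where B: "same_symbol j s B" "intertwines f M M' s B"
    using iso s unfolding symbol_iso_def by blast
  have "f ` R = filt M' (f v) (int m - 1) +>\<^bsub>M'\<^esub> f (lact M s y)"
    unfolding R
    by (rule linear_iso_coset[OF M.complex_space_axioms M'.complex_space_axioms linear
        M.filt_subspace[OF v] f_filt]) (simp add: yc)
  also have "f (lact M s y) = lact M' B (f y)" using B(2) yc by (simp add: intertwines_def)
  also have "filt M' (f v) (int m - 1) +>\<^bsub>M'\<^esub> \<dots> = filt M' (f v) (int m - 1) +>\<^bsub>M'\<^esub> lact M' s (f y)"
  proof (cases "j = 0")
    case True
    then show ?thesis using B(1) by (simp add: same_symbol_def)
  next
    case False
    have "lact M' (B - s) (f y) \<in> filt M' (f v) (int (m - j) + int (j - 1))"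
      using B(1) False by (intro M'.filt_lact[OF v' _ fy]) (simp add: same_symbol_def)
    also have "int (m - j) + int (j - 1) = int m - 1" using False \<open>j \<le> m\<close> by auto
    finally show ?thesis
      using yc M'.lact_add_left[of "f y" "B - s" s]
      by (intro M'.coset_eqI[OF M'.filt_subspace[OF v']]) auto
  qed
  finally show "f ` R = (\<Union>x\<in>f ` C. filt M' (f v) (int m - 1) +>\<^bsub>M'\<^esub> lact M' s x)"
    unfolding R' .
qed

lemma piece_space': "complex_space (gr_piece M' (f v) m)"
  unfolding gr_piece_def
  by (intro complex_space.quot_complex_space M'.subspace_complex_space M'.filt_subspace v'
      subspace_of_carrier_update M'.filt_mono) simp

lemma gr_module_isomorphic: "lmodule_isomorphic (gr_module M v) (gr_module M' (f v))"
proof -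
  let ?F = "\<lambda>w m. f ` w m"
  let ?Q = "gr_piece M v" and ?Q' = "gr_piece M' (f v)"
  have ab: "abelian_monoid (?Q m)" "abelian_monoid (?Q' m)" for m
    using piece_space[of m] piece_space'[of m]
    by (simp_all add: complex_space_def abelian_group_def)
  have zero: "\<zero>\<^bsub>?Q m\<^esub> \<in> carrier (?Q m)" for m
    by (rule abelian_monoid.zero_closed[OF ab(1)])
  have F0: "f ` \<zero>\<^bsub>?Q m\<^esub> = \<zero>\<^bsub>?Q' m\<^esub>" for m
    by (rule linear_iso_zero[OF piece_space piece_space' piece_iso])
  have bij: "bij_betw ?F (carrier (direct_sum ?Q)) (carrier (direct_sum ?Q'))"
    by (rule direct_sum_bij) (use piece_iso zero F0 in \<open>auto simp: linear_iso_def\<close>)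
  have carrier: "w m \<in> carrier (?Q m)" if "w \<in> carrier (direct_sum ?Q)" for w m
    using that by (simp add: direct_sum_def)
  have fin: "f ` finsum (?Q m) C {..m} = finsum (?Q' m) (\<lambda>j. f ` C j) {..m}"
    if "C \<in> {..m} \<rightarrow> carrier (?Q m)" for C m
    by (rule finsum_additive[OF ab])
       (use piece_iso[of m] F0 that in \<open>auto simp: linear_iso_def bij_betw_def\<close>)
  have act: "?F (lact (gr_module M v) g w) = lact (gr_module M' (f v)) g (?F w)"
    if w: "w \<in> carrier (direct_sum ?Q)" for g w
  proof
    fix m
    let ?C = "\<lambda>j. \<Union>x\<in>w (m - j). filt M v (int m - 1) +>\<^bsub>M\<^esub> lact M (symbol_lift j g) x"
    let ?C' = "\<lambda>j. \<Union>x\<in>f ` w (m - j). filt M' (f v) (int m - 1) +>\<^bsub>M'\<^esub> lact M' (symbol_lift j g) x"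
    have C: "?C j \<in> carrier (?Q m)" "f ` ?C j = ?C' j" if "j \<in> {..m}" for j
      using action_component[OF carrier[OF w], of j m g] that by auto
    interpret Q': abelian_monoid "?Q' m" by (rule ab)
    have "f ` finsum (?Q m) ?C {..m} = finsum (?Q' m) (\<lambda>j. f ` ?C j) {..m}"
      by (rule fin) (use C in auto)
    also have "\<dots> = finsum (?Q' m) ?C' {..m}"
    proof (rule Q'.finsum_cong')
      have "f ` ?C j \<in> carrier (?Q' m)" if "j \<in> {..m}" for j
        using C(1)[OF that] piece_iso[of m] by (auto simp: linear_iso_def bij_betw_def)
      then show "?C' \<in> {..m} \<rightarrow> carrier (?Q' m)" using C(2) by auto
    qed (use C in auto)
    finally show "?F (lact (gr_module M v) g w) m = lact (gr_module M' (f v)) g (?F w) m"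
      by (simp add: gr_module_def)
  qed
  show ?thesis
    unfolding lmodule_isomorphic_def
  proof (intro exI[of _ ?F] conjI ballI allI)
    show "bij_betw ?F (carrier (gr_module M v)) (carrier (gr_module M' (f v)))"
      using bij by (simp add: gr_module_def)
  next
    fix w w' assume "w \<in> carrier (gr_module M v)" "w' \<in> carrier (gr_module M v)"
    then show "?F (w \<oplus>\<^bsub>gr_module M v\<^esub> w') = ?F w \<oplus>\<^bsub>gr_module M' (f v)\<^esub> ?F w'"
      using piece_iso by (auto simp: gr_module_def direct_sum_def linear_iso_def)
  next
    fix c w assume "w \<in> carrier (gr_module M v)"
    then show "?F (c \<odot>\<^bsub>gr_module M v\<^esub> w) = c \<odot>\<^bsub>gr_module M' (f v)\<^esub> ?F w"
      using piece_iso by (auto simp: gr_module_def direct_sum_def linear_iso_def)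
  next
    fix g w assume "w \<in> carrier (gr_module M v)"
    then show "?F (lact (gr_module M v) g w) = lact (gr_module M' (f v)) g (?F w)"
      by (intro act) (simp add: gr_module_def)
  qed
qed

end

section \<open>Quotients of spaces with operators\<close>

lemma quot_lmodule_simps:
  "carrier (quot_lmodule M W) = carrier (quot_space M W)"
  "add (quot_lmodule M W) = add (quot_space M W)"
  "zero (quot_lmodule M W) = zero (quot_space M W)"
  "smult (quot_lmodule M W) = smult (quot_space M W)"
  by (simp_all add: quot_lmodule_def)

lemma complex_space_cong:
  assumes "carrier M = carrier M'" "add M = add M'" "zero M = zero M'" "smult M = smult M'"
    and "complex_space M"
  shows "complex_space M'"
proof -
  interpret M: complex_space M by fact
  have "abelian_group M'"
    by (rule abelian_groupI)
       (use abelian_groupE[OF M.abelian_group_axioms, unfolded assms(1-4)] in blast)+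
  then show ?thesis
    by (intro complex_space.intro complex_space_axioms.intro)
       (simp_all add: M.smult_closed[unfolded assms(1-4)] M.smult_add_left[unfolded assms(1-4)]
          M.smult_add_right[unfolded assms(1-4)] M.smult_smult[unfolded assms(1-4)]
          M.smult_one[unfolded assms(1-4)])
qed

text \<open>Operators on a space that need not form a Lie algebra action but induce operators on a quotient.
This covers both the truncated Laurent vectors and the exterior powers; on formal sums of tuples
the derivation of a sum is not the sum of the derivations, since multilinearity holds only
after passing to the quotient.\<close>

locale operator_quotient = complex_space M for M :: "('n::finite glxy, 'a) lmodule" (structure) +
  fixes W
  assumes W: "subspace_of M W"
    and op_closed: "x \<in> carrier M \<Longrightarrow> lact M A x \<in> carrier M"
    and op_add: "x \<in> carrier M \<Longrightarrow> y \<in> carrier M \<Longrightarrow> lact M A (x \<oplus> y) = lact M A x \<oplus> lact M A y"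
    and op_smult: "x \<in> carrier M \<Longrightarrow> lact M A (c \<odot> x) = c \<odot> lact M A x"
    and op_W: "x \<in> W \<Longrightarrow> lact M A x \<in> W"
begin

lemma lact_quot:
  "x \<in> carrier M \<Longrightarrow> lact (quot_lmodule M W) A (W +> x) = W +> lact M A x"
  using induced_coset[OF W complex_space_axioms W, of "lact M A" x]
  by (simp add: quot_lmodule_def op_closed op_add op_W)

lemma lie_module_quot:
  assumes "\<And>A B x. x \<in> carrier M \<Longrightarrow> \<exists>w\<in>W. lact M (A + B) x = w \<oplus> (lact M A x \<oplus> lact M B x)"
    and "\<And>c A x. x \<in> carrier M \<Longrightarrow> \<exists>w\<in>W. lact M (glxy_scale c A) x = w \<oplus> (c \<odot> lact M A x)"
    and "\<And>A B x. x \<in> carrier M \<Longrightarrow> \<exists>w\<in>W. lact M A (lact M B x) =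
      w \<oplus> (lact M (glxy_bracket A B) x \<oplus> lact M B (lact M A x))"
  shows "lie_module (quot_lmodule M W)"
proof -
  note simps = quot_lmodule_simps quot_add[OF W] quot_smult[OF W] lact_quot
  have mem: "W +> a \<in> carrier (quot_space M W)" if "a \<in> carrier M" for a
    using that by (simp add: quot_carrier)
  have E: thesis if "C \<in> carrier (quot_lmodule M W)" "\<And>a. a \<in> carrier M \<Longrightarrow> C = W +> a \<Longrightarrow> thesis" for C thesis
    using that by (auto simp: quot_lmodule_simps quot_carrier)
  have coset: "W +> x = W +> y" if "\<exists>w\<in>W. x = w \<oplus> y" "y \<in> carrier M" for x y
    using that coset_eqI[OF W] by blast
  show ?thesis
  proof (intro lie_module.intro lie_module_axioms.intro)
    show "complex_space (quot_lmodule M W)"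
      by (rule complex_space_cong[OF _ _ _ _ quot_complex_space[OF W]]) (simp_all add: quot_lmodule_simps)
  next
    fix C A B assume "C \<in> carrier (quot_lmodule M W)"
    then obtain a where a: "a \<in> carrier M" "C = W +> a" by (rule E)
    show "lact (quot_lmodule M W) (A + B) C =
        lact (quot_lmodule M W) A C \<oplus>\<^bsub>quot_lmodule M W\<^esub> lact (quot_lmodule M W) B C"
      using coset[OF assms(1)[OF a(1)]] a by (simp add: simps op_closed)
  next
    fix C A c assume "C \<in> carrier (quot_lmodule M W)"
    then obtain a where a: "a \<in> carrier M" "C = W +> a" by (rule E)
    show "lact (quot_lmodule M W) (glxy_scale c A) C =
        c \<odot>\<^bsub>quot_lmodule M W\<^esub> lact (quot_lmodule M W) A C"
      using coset[OF assms(2)[OF a(1)]] a by (simp add: simps op_closed)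
  next
    fix C A B assume "C \<in> carrier (quot_lmodule M W)"
    then obtain a where a: "a \<in> carrier M" "C = W +> a" by (rule E)
    show "lact (quot_lmodule M W) A (lact (quot_lmodule M W) B C) =
        lact (quot_lmodule M W) (glxy_bracket A B) C \<oplus>\<^bsub>quot_lmodule M W\<^esub>
          lact (quot_lmodule M W) B (lact (quot_lmodule M W) A C)"
      using coset[OF assms(3)[OF a(1)], of A B] a by (simp add: simps op_closed)
  qed ((elim E)?, simp add: simps mem op_closed op_add op_smult)+
qed

end

lemma vspace_complex_space:
  fixes C :: "'a::ab_group_add set"
  assumes "vector_space sc" "module.subspace sc C"
  shows "complex_space (vspace C (+) 0 sc)"
proof -
  interpret V: vector_space sc by fact
  show ?thesis
    by (intro complex_space.intro abelian_groupI complex_space_axioms.intro)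
       (use V.subspace_0[OF assms(2)] V.subspace_add[OF assms(2)] V.subspace_scale[OF assms(2)]
          V.subspace_neg[OF assms(2)]
        in \<open>auto simp: algebra_simps V.scale_left_distrib V.scale_right_distrib intro!: bexI[of _ "- x" for x]\<close>)
qed

lemma with_action_complex_space: "complex_space M \<Longrightarrow> complex_space (with_action M act)"
  by (rule complex_space_cong[of M]) simp_all

lemma linear_iso_cong:
  assumes "carrier M = carrier N" "add M = add N" "smult M = smult N"
    and "carrier M' = carrier N'" "add M' = add N'" "smult M' = smult N'"
  shows "linear_iso f M M' = linear_iso f N N'"
  unfolding linear_iso_def assms ..

lemma operator_quotient_transport:
  assumes "operator_quotient M W" "operator_quotient M' W'" "linear_iso f M M'" "f ` W = W'"
  shows "linear_iso ((`) f) (quot_lmodule M W) (quot_lmodule M' W')"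
    and "intertwines f M M' A B \<Longrightarrow> intertwines ((`) f) (quot_lmodule M W) (quot_lmodule M' W') A B"
proof -
  interpret M: operator_quotient M W by fact
  interpret M': operator_quotient M' W' by fact
  show "linear_iso ((`) f) (quot_lmodule M W) (quot_lmodule M' W')"
    using linear_iso_quot[OF M.complex_space_axioms M'.complex_space_axioms assms(3) M.W assms(4) M'.W]
    by (subst linear_iso_cong) (rule quot_lmodule_simps)+
  assume AB: "intertwines f M M' A B"
  have fc: "f x \<in> carrier M'" if "x \<in> carrier M" for x
    using assms(3) that by (auto simp: linear_iso_def bij_betw_def)
  note co = linear_iso_coset[OF M.complex_space_axioms M'.complex_space_axioms assms(3) M.W assms(4)]
  show "intertwines ((`) f) (quot_lmodule M W) (quot_lmodule M' W') A B"
    unfolding intertwines_def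
  proof
    fix C assume "C \<in> carrier (quot_lmodule M W)"
    then obtain x where x: "x \<in> carrier M" "C = W +>\<^bsub>M\<^esub> x"
      by (auto simp: quot_lmodule_simps M.quot_carrier)
    then have "f (lact M A x) = lact M' B (f x)" using AB by (simp add: intertwines_def)
    with x show "f ` lact (quot_lmodule M W) A C = lact (quot_lmodule M' W') B (f ` C)"
      by (simp add: M.lact_quot M'.lact_quot co fc M.op_closed)
  qed
qed

section \<open>Exterior powers\<close>

subsection \<open>The derivation induced on tuples\<close>

abbreviation single1 :: "'a \<Rightarrow> 'a \<Rightarrow>\<^sub>0 complex" where
  "single1 k \<equiv> Poly_Mapping.single k 1"

lemma leibniz_add: "leibniz D (p + q) = leibniz D p + leibniz D q"
  unfolding leibniz_def
  by (rule setsum_keys_plus_distrib) (simp_all add: single_add sum.distrib)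

lemma leibniz_zero [simp]: "leibniz D 0 = 0"
  by (simp add: leibniz_def)

lemma leibniz_single:
  "leibniz D (Poly_Mapping.single vs c) = (\<Sum>i<length vs. Poly_Mapping.single (vs[i := D (vs ! i)]) c)"
  by (cases "c = 0") (simp_all add: leibniz_def)

lemma pscale_add: "pscale c (p + q) = pscale c p + pscale c q"
  by (rule pm.scale_right_distrib)

lemma leibniz_pscale: "leibniz D (pscale c p) = pscale c (leibniz D p)"
  by (induction p rule: poly_mapping_add_induct)
     (simp_all add: leibniz_add pscale_add leibniz_single pm.scale_sum_right)

lemma leibniz_sum: "leibniz D (sum g I) = (\<Sum>i\<in>I. leibniz D (g i))"
  by (induction I rule: infinite_finite_induct) (simp_all add: leibniz_add)

lemma leibniz_diff: "leibniz D (p - q) = leibniz D p - leibniz D q"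
  using leibniz_add[of D "p - q" q] by simp

lemma keys_subset_span:
  assumes "Poly_Mapping.keys p \<subseteq> T"
  shows "p \<in> pm.span (single1 ` T)"
proof -
  have "p = (\<Sum>k\<in>Poly_Mapping.keys p. pscale (Poly_Mapping.lookup p k) (single1 k))"
    using poly_mapping_sum_single[of p] by simp
  also have "\<dots> \<in> pm.span (single1 ` T)"
    using assms by (intro pm.span_sum pm.span_scale pm.span_base) auto
  finally show ?thesis .
qed

lemma keys_subset_subspace: "pm.subspace {p. Poly_Mapping.keys p \<subseteq> T}"
proof (rule pm.subspaceI)
  fix p q :: "'a \<Rightarrow>\<^sub>0 complex" and c
  assume p: "p \<in> {p. Poly_Mapping.keys p \<subseteq> T}"
  then show "pscale c p \<in> {p. Poly_Mapping.keys p \<subseteq> T}"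
    by (auto simp: in_keys_iff subset_iff)
  assume "q \<in> {p. Poly_Mapping.keys p \<subseteq> T}"
  with p show "p + q \<in> {p. Poly_Mapping.keys p \<subseteq> T}"
    using keys_add[of p q] by blast
qed simp

locale exterior = M: lie_module M for M :: "('n::finite glxy, 'a) lmodule" +
  fixes k :: nat
begin

abbreviation "W \<equiv> wedge_relations M k"

abbreviation T :: "('n glxy, 'a list \<Rightarrow>\<^sub>0 complex) lmodule" where
  "T \<equiv> with_action (tuple_space M k) (\<lambda>A. leibniz (lact M A))"

lemma tuples_update: "vs \<in> tuples M k \<Longrightarrow> x \<in> carrier M \<Longrightarrow> vs[i := x] \<in> tuples M k"
  using set_update_subset_insert[of vs i x] by (auto simp: tuples_def)

lemma tuples_nth: "vs \<in> tuples M k \<Longrightarrow> i < k \<Longrightarrow> vs ! i \<in> carrier M"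
  by (auto simp: tuples_def)

lemma tuples_length: "vs \<in> tuples M k \<Longrightarrow> length vs = k"
  by (simp add: tuples_def)

text \<open>Induction over the generators of the relations, with the changed entry addressed by its index
instead of by splitting the list.\<close>

lemma W_cases:
  assumes "p \<in> W" "pm.subspace S"
    and add: "\<And>vs i x y. vs \<in> tuples M k \<Longrightarrow> i < k \<Longrightarrow> x \<in> carrier M \<Longrightarrow> y \<in> carrier M \<Longrightarrow>
      single1 (vs[i := x \<oplus>\<^bsub>M\<^esub> y]) - single1 (vs[i := x]) - single1 (vs[i := y]) \<in> S"
    and smult: "\<And>vs i c x. vs \<in> tuples M k \<Longrightarrow> i < k \<Longrightarrow> x \<in> carrier M \<Longrightarrow>
      single1 (vs[i := c \<odot>\<^bsub>M\<^esub> x]) - Poly_Mapping.single (vs[i := x]) c \<in> S"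
    and alt: "\<And>vs. vs \<in> tuples M k \<Longrightarrow> \<not> distinct vs \<Longrightarrow> single1 vs \<in> S"
  shows "p \<in> S"
proof -
  have upd: "us @ [z] @ vs = (us @ [x] @ vs)[length us := z]" for us vs x and z :: 'a by simp
  have "us @ [x] @ vs \<in> tuples M k \<Longrightarrow> length us < k \<and> x \<in> carrier M" for us vs x
    by (auto simp: tuples_def)
  then have gen: "single1 (us @ [x \<oplus>\<^bsub>M\<^esub> y] @ vs) - single1 (us @ [x] @ vs) - single1 (us @ [y] @ vs) \<in> S"
    "single1 (us @ [c \<odot>\<^bsub>M\<^esub> x] @ vs) - Poly_Mapping.single (us @ [x] @ vs) c \<in> S"
    if "us @ [x] @ vs \<in> tuples M k" "y \<in> carrier M" for us x y vs c
    using that add[of "us @ [x] @ vs" "length us" x y] smult[of "us @ [x] @ vs" "length us" x c]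
    by auto
  have "W \<subseteq> S"
    unfolding wedge_relations_def
  proof (rule pm.span_minimal[OF _ assms(2)], intro Un_least subsetI)
  qed (use gen(1) gen(2)[OF _ M.zero_closed] alt in \<open>blast+\<close>)
  then show ?thesis using assms(1) by blast
qed

lemma W_subspace: "pm.subspace W"
  unfolding wedge_relations_def by (rule pm.subspace_span)

lemmas W_add = pm.subspace_add[OF W_subspace]
lemmas W_diff = pm.subspace_diff[OF W_subspace]
lemmas W_sum = pm.subspace_sum[OF W_subspace]

lemma rel_add:
  assumes "vs \<in> tuples M k" "i < k" "x \<in> carrier M" "y \<in> carrier M"
  shows "single1 (vs[i := x \<oplus>\<^bsub>M\<^esub> y]) - single1 (vs[i := x]) - single1 (vs[i := y]) \<in> W"
proof -
  have upd: "vs[i := z] = take i vs @ [z] @ drop (Suc i) vs" for z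
    using assms(1,2) by (simp add: upd_conv_take_nth_drop tuples_length)
  show ?thesis
    using tuples_update[OF assms(1,3), of i] assms(4) unfolding wedge_relations_def upd
    by (intro pm.span_base UnI1) blast
qed

lemma rel_smult:
  assumes "vs \<in> tuples M k" "i < k" "x \<in> carrier M"
  shows "single1 (vs[i := c \<odot>\<^bsub>M\<^esub> x]) - Poly_Mapping.single (vs[i := x]) c \<in> W"
proof -
  have upd: "vs[i := z] = take i vs @ [z] @ drop (Suc i) vs" for z
    using assms(1,2) by (simp add: upd_conv_take_nth_drop tuples_length)
  show ?thesis
    using tuples_update[OF assms(1,3), of i] unfolding wedge_relations_def upd
    by (intro pm.span_base UnI1 UnI2) blast
qed

lemma rel_alt: "vs \<in> tuples M k \<Longrightarrow> \<not> distinct vs \<Longrightarrow> single1 vs \<in> W"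
  unfolding wedge_relations_def by (intro pm.span_base) blast

lemma W_tuples: "p \<in> W \<Longrightarrow> Poly_Mapping.keys p \<subseteq> tuples M k"
proof -
  assume "p \<in> W"
  then have "p \<in> {p. Poly_Mapping.keys p \<subseteq> tuples M k}"
  proof (rule W_cases)
    note subspace = keys_subset_subspace[of "tuples M k"]
    have s: "Poly_Mapping.single vs c \<in> {p. Poly_Mapping.keys p \<subseteq> tuples M k}"
      if "vs \<in> tuples M k" for vs c using that by simp
    show "single1 (vs[i := x \<oplus>\<^bsub>M\<^esub> y]) - single1 (vs[i := x]) - single1 (vs[i := y])
        \<in> {p. Poly_Mapping.keys p \<subseteq> tuples M k}"
      if "vs \<in> tuples M k" "x \<in> carrier M" "y \<in> carrier M" for vs i x y
      by (intro pm.subspace_diff[OF subspace] s tuples_update that M.a_closed)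
    show "single1 (vs[i := c \<odot>\<^bsub>M\<^esub> x]) - Poly_Mapping.single (vs[i := x]) c
        \<in> {p. Poly_Mapping.keys p \<subseteq> tuples M k}"
      if "vs \<in> tuples M k" "x \<in> carrier M" for vs i x c
      by (intro pm.subspace_diff[OF subspace] s tuples_update that M.smult_closed)
  qed (simp_all add: keys_subset_subspace)
  then show ?thesis by simp
qed

text \<open>Polarisation: expand the tuple with \<open>x + y\<close> in both places, and drop the three tuples with
a repeated entry.\<close>

lemma rel_swap:
  assumes "vs \<in> tuples M k" "i < k" "j < k" "i \<noteq> j" "x \<in> carrier M" "y \<in> carrier M"
  shows "single1 (vs[i := x, j := y]) + single1 (vs[i := y, j := x]) \<in> W"
proof -
  let ?s = "\<lambda>a b. single1 (vs[i := a, j := b])"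
  have len: "length vs = k" using assms(1) by (rule tuples_length)
  have alt: "?s a a \<in> W" if "a \<in> carrier M" for a
  proof (rule rel_alt)
    show "vs[i := a, j := a] \<in> tuples M k" by (intro tuples_update assms(1) that)
    show "\<not> distinct (vs[i := a, j := a])"
      using nth_eq_iff_index_eq[of "vs[i := a, j := a]" i j] assms(2-4) len
      by (auto simp: nth_list_update)
  qed
  have right: "?s a (x \<oplus>\<^bsub>M\<^esub> y) - ?s a x - ?s a y \<in> W" if "a \<in> carrier M" for a
    by (intro rel_add tuples_update assms that)
  have left: "?s (x \<oplus>\<^bsub>M\<^esub> y) b - ?s x b - ?s y b \<in> W" if "b \<in> carrier M" for b
    unfolding list_update_swap[OF \<open>i \<noteq> j\<close>] by (intro rel_add tuples_update assms that)
  \<comment> \<open>The corrections in brackets expand the first and then the second place.\<close>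
  have "?s x y + ?s y x = ?s (x \<oplus>\<^bsub>M\<^esub> y) (x \<oplus>\<^bsub>M\<^esub> y) - ?s x x - ?s y y
      - (?s (x \<oplus>\<^bsub>M\<^esub> y) (x \<oplus>\<^bsub>M\<^esub> y) - ?s x (x \<oplus>\<^bsub>M\<^esub> y) - ?s y (x \<oplus>\<^bsub>M\<^esub> y))
      - (?s x (x \<oplus>\<^bsub>M\<^esub> y) - ?s x x - ?s x y) - (?s y (x \<oplus>\<^bsub>M\<^esub> y) - ?s y x - ?s y y)"
    by (simp add: algebra_simps)
  also have "\<dots> \<in> W"
    by (intro W_diff alt left right M.a_closed assms)
  finally show ?thesis .
qed

text \<open>Differentiating a multilinearity relation in an entry other than the distinguished one gives such a
relation again, and in the distinguished entry it is linearity of the operator. For a tuple with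
equal entries at \<open>a\<close> and \<open>b\<close>, all terms still have this repetition except those
differentiated at \<open>a\<close> or at \<open>b\<close>; these two differ by a transposition and cancel.\<close>

lemma leibniz_W:
  assumes "p \<in> W" shows "leibniz (lact M A) p \<in> W"
proof -
  let ?D = "leibniz (lact M A)"
  have "p \<in> {p. ?D p \<in> W}"
    using assms
  proof (rule W_cases)
    show "pm.subspace {p. ?D p \<in> W}"
      using W_subspace by (simp add: pm.subspace_def leibniz_add leibniz_pscale)
  next
    fix vs i x y
    assume vs: "vs \<in> tuples M k" "i < k" and xy: "x \<in> carrier M" "y \<in> carrier M"
    note len = tuples_length[OF vs(1)]
    have "single1 (vs[i := x \<oplus>\<^bsub>M\<^esub> y, j := lact M A (vs[i := x \<oplus>\<^bsub>M\<^esub> y] ! j)])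
       - single1 (vs[i := x, j := lact M A (vs[i := x] ! j)])
       - single1 (vs[i := y, j := lact M A (vs[i := y] ! j)]) \<in> W" if "j < k" for j
    proof (cases "j = i")
      case True
      then show ?thesis
        using vs xy by (simp add: len M.lact_add rel_add)
    next
      case False
      then show ?thesis
        using rel_add[OF tuples_update[OF vs(1), of "lact M A (vs ! j)" j] vs(2) xy] tuples_nth[OF vs(1) that]
        by (simp add: list_update_swap[of i j])
    qed
    then show "single1 (vs[i := x \<oplus>\<^bsub>M\<^esub> y]) - single1 (vs[i := x]) - single1 (vs[i := y]) \<in> {p. ?D p \<in> W}"
      by (auto simp: leibniz_diff leibniz_single len sum_subtractf[symmetric] intro!: W_sum)
  next
    fix vs i c x
    assume vs: "vs \<in> tuples M k" "i < k" and x: "x \<in> carrier M"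
    note len = tuples_length[OF vs(1)]
    have "single1 (vs[i := c \<odot>\<^bsub>M\<^esub> x, j := lact M A (vs[i := c \<odot>\<^bsub>M\<^esub> x] ! j)])
       - Poly_Mapping.single (vs[i := x, j := lact M A (vs[i := x] ! j)]) c \<in> W" if "j < k" for j
    proof (cases "j = i")
      case True
      then show ?thesis
        using vs x by (simp add: len M.lact_smult rel_smult)
    next
      case False
      then show ?thesis
        using rel_smult[OF tuples_update[OF vs(1), of "lact M A (vs ! j)" j] vs(2) x] tuples_nth[OF vs(1) that]
        by (simp add: list_update_swap[of i j])
    qed
    then show "single1 (vs[i := c \<odot>\<^bsub>M\<^esub> x]) - Poly_Mapping.single (vs[i := x]) c \<in> {p. ?D p \<in> W}"
      by (auto simp: leibniz_diff leibniz_single len sum_subtractf[symmetric] intro!: W_sum)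
  next
    fix vs assume vs: "vs \<in> tuples M k" "\<not> distinct vs"
    note len = tuples_length[OF vs(1)]
    from vs(2) obtain a b where ab: "a < k" "b < k" "a \<noteq> b" "vs ! a = vs ! b"
      unfolding distinct_conv_nth len by blast
    let ?s = "\<lambda>j. single1 (vs[j := lact M A (vs ! j)])"
    have car: "lact M A (vs ! j) \<in> carrier M" if "j < k" for j using tuples_nth[OF vs(1) that] by simp
    have "vs[a := vs ! a, b := lact M A (vs ! b)] = vs[b := lact M A (vs ! b)]"
      "vs[a := lact M A (vs ! a), b := vs ! a] = vs[a := lact M A (vs ! a)]"
      by (simp, unfold list_update_swap[OF ab(3)] ab(4), simp)
    then have pair: "?s b + ?s a \<in> W"
      using rel_swap[OF vs(1) ab(1-3) tuples_nth[OF vs(1) ab(1)] car[OF ab(2)]] ab(4) by simp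
    have rest: "?s j \<in> W" if "j \<in> {..<k} - {a, b}" for j
    proof (rule rel_alt)
      show "vs[j := lact M A (vs ! j)] \<in> tuples M k"
        using that by (intro tuples_update vs(1) car) simp
      show "\<not> distinct (vs[j := lact M A (vs ! j)])"
        using nth_eq_iff_index_eq[of "vs[j := lact M A (vs ! j)]" a b] that ab len
        by (auto simp: nth_list_update)
    qed
    have sum: "(\<Sum>j<k. ?s j) = (\<Sum>j\<in>{..<k} - {a, b}. ?s j) + (?s b + ?s a)"
      using ab by (subst sum.subset_diff[of "{a, b}"]) (auto simp: add.commute)
    have "(\<Sum>j<k. ?s j) \<in> W" unfolding sum by (intro W_add W_sum rest pair)
    then show "single1 vs \<in> {p. ?D p \<in> W}" by (simp add: leibniz_single len)
  qed
  then show ?thesis by simp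
qed

text \<open>Identities between derivations modulo the relations need to be checked on single tuples only.\<close>

lemma tuple_induct:
  assumes "Poly_Mapping.keys p \<subseteq> tuples M k"
    and "\<And>p q. g (p + q) = g p + g q" "\<And>c p. g (pscale c p) = pscale c (g p)"
    and "\<And>vs. vs \<in> tuples M k \<Longrightarrow> g (single1 vs) \<in> W"
  shows "g p \<in> W"
proof -
  have "g 0 = 0" using assms(3)[of 0 0] by simp
  then have "pm.subspace {p. g p \<in> W}"
    using W_subspace assms(2,3) by (simp add: pm.subspace_def)
  then show ?thesis
    using pm.span_induct[OF keys_subset_span[OF assms(1)], of "\<lambda>p. g p \<in> W"] assms(4) by auto
qed

end

subsection \<open>Exterior powers of modules are modules\<close>

lemma tuple_space_simps [simp]:
  "carrier (tuple_space M k) = {p. Poly_Mapping.keys p \<subseteq> tuples M k}"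
  "add (tuple_space M k) = (+)" "zero (tuple_space M k) = 0" "smult (tuple_space M k) = pscale"
  by (simp_all add: tuple_space_def)

context exterior
begin

lemma T_carrier: "carrier T = {p. Poly_Mapping.keys p \<subseteq> tuples M k}"
  by (simp add: tuple_space_def)

lemma T_simps: "add T = (+)" "zero T = 0" "smult T = pscale" "lact T = (\<lambda>A. leibniz (lact M A))"
  by (simp_all add: tuple_space_def)

lemma T_space: "complex_space T"
  unfolding tuple_space_def
  by (intro with_action_complex_space vspace_complex_space pm.vector_space_axioms keys_subset_subspace)

lemma W_subspace_of: "subspace_of T W"
  using W_tuples W_subspace by (auto simp: subspace_of_def T_carrier T_simps pm.subspace_def)

lemma leibniz_closed:
  assumes "Poly_Mapping.keys p \<subseteq> tuples M k"
  shows "Poly_Mapping.keys (leibniz (lact M A) p) \<subseteq> tuples M k"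
proof -
  have "leibniz (lact M A) p \<in> {p. Poly_Mapping.keys p \<subseteq> tuples M k}"
    unfolding leibniz_def
  proof (intro pm.subspace_sum[OF keys_subset_subspace])
    fix vs i assume "vs \<in> Poly_Mapping.keys p" "i \<in> {..<length vs}"
    then have "vs[i := lact M A (vs ! i)] \<in> tuples M k"
      using assms tuples_nth[of vs i] tuples_length[of vs] by (intro tuples_update) auto
    then show "Poly_Mapping.single (vs[i := lact M A (vs ! i)]) (Poly_Mapping.lookup p vs)
        \<in> {p. Poly_Mapping.keys p \<subseteq> tuples M k}" by simp
  qed
  then show ?thesis by simp
qed

lemma operator_quotient_T: "operator_quotient T W"
  by (intro operator_quotient.intro operator_quotient_axioms.intro T_space W_subspace_of)
     (simp_all add: T_carrier T_simps leibniz_closed leibniz_add leibniz_pscale leibniz_W)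

lemma leibniz_add_left:
  assumes "Poly_Mapping.keys p \<subseteq> tuples M k"
  shows "leibniz (lact M (A + B)) p - (leibniz (lact M A) p + leibniz (lact M B) p) \<in> W"
  using assms
proof (rule tuple_induct)
  fix vs assume vs: "vs \<in> tuples M k"
  have "single1 (vs[i := lact M (A + B) (vs ! i)]) - single1 (vs[i := lact M A (vs ! i)])
      - single1 (vs[i := lact M B (vs ! i)]) \<in> W" if "i < k" for i
    using rel_add[OF vs that] tuples_nth[OF vs that] by (simp add: M.lact_add_left)
  then show "leibniz (lact M (A + B)) (single1 vs)
      - (leibniz (lact M A) (single1 vs) + leibniz (lact M B) (single1 vs)) \<in> W"
    by (auto simp: leibniz_single tuples_length[OF vs] sum.distrib[symmetric]
        sum_subtractf[symmetric] diff_diff_add[symmetric] simp del: diff_diff_add intro!: W_sum)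
qed (simp_all add: leibniz_add leibniz_pscale pm.scale_right_distrib pm.scale_right_diff_distrib)

lemma leibniz_scale_left:
  assumes "Poly_Mapping.keys p \<subseteq> tuples M k"
  shows "leibniz (lact M (glxy_scale c A)) p - pscale c (leibniz (lact M A) p) \<in> W"
  using assms
proof (rule tuple_induct)
  fix vs assume vs: "vs \<in> tuples M k"
  have "single1 (vs[i := lact M (glxy_scale c A) (vs ! i)])
      - Poly_Mapping.single (vs[i := lact M A (vs ! i)]) c \<in> W" if "i < k" for i
    using rel_smult[OF vs that] tuples_nth[OF vs that] by (simp add: M.lact_scale_left)
  then show "leibniz (lact M (glxy_scale c A)) (single1 vs)
      - pscale c (leibniz (lact M A) (single1 vs)) \<in> W"
    by (auto simp: leibniz_single tuples_length[OF vs] pm.scale_sum_right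
        sum_subtractf[symmetric] intro!: W_sum)
next
  fix p q
  show "leibniz (lact M (glxy_scale c A)) (p + q) - pscale c (leibniz (lact M A) (p + q))
    = (leibniz (lact M (glxy_scale c A)) p - pscale c (leibniz (lact M A) p))
      + (leibniz (lact M (glxy_scale c A)) q - pscale c (leibniz (lact M A) q))"
    by (simp add: leibniz_add pm.scale_right_distrib)
next
  fix d p
  show "leibniz (lact M (glxy_scale c A)) (pscale d p) - pscale c (leibniz (lact M A) (pscale d p))
    = pscale d (leibniz (lact M (glxy_scale c A)) p - pscale c (leibniz (lact M A) p))"
    by (simp add: leibniz_pscale pm.scale_right_diff_distrib mult.commute)
qed

text \<open>The second sum, where the operators hit different entries, is symmetric under exchanging them and
cancels in a commutator. What remains is the commutator of the operators in each entry.\<close>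

lemma leibniz_leibniz_single:
  fixes D E :: "'a \<Rightarrow> 'a"
  assumes "length vs = k"
  shows "leibniz D (leibniz E (single1 vs)) = (\<Sum>i<k. single1 (vs[i := D (E (vs ! i))])) +
    (\<Sum>i<k. \<Sum>j<k. if i = j then 0 else single1 (vs[i := E (vs ! i), j := D (vs ! j)]))"
proof -
  have "(\<Sum>j<k. single1 (vs[i := E (vs ! i), j := D (vs[i := E (vs ! i)] ! j)])) =
      single1 (vs[i := D (E (vs ! i))]) +
      (\<Sum>j<k. if i = j then 0 else single1 (vs[i := E (vs ! i), j := D (vs ! j)]))" if "i < k" for i
  proof -
    let ?g = "\<lambda>j. single1 (vs[i := E (vs ! i), j := D (vs[i := E (vs ! i)] ! j)])"
    have "sum ?g {..<k} = ?g i + sum ?g ({..<k} - {i})"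
      using that by (intro sum.remove) auto
    also have "?g i = single1 (vs[i := D (E (vs ! i))])" using that assms by simp
    also have "sum ?g ({..<k} - {i}) =
        (\<Sum>j<k. if i = j then 0 else single1 (vs[i := E (vs ! i), j := D (vs ! j)]))"
      by (rule sum.mono_neutral_cong_left) auto
    finally show ?thesis .
  qed
  then show ?thesis
    by (simp add: leibniz_single leibniz_sum assms sum.distrib[symmetric])
qed

lemma leibniz_bracket:
  assumes "Poly_Mapping.keys p \<subseteq> tuples M k"
  shows "leibniz (lact M A) (leibniz (lact M B) p) - (leibniz (lact M (glxy_bracket A B)) p
      + leibniz (lact M B) (leibniz (lact M A) p)) \<in> W"
  using assms
proof (rule tuple_induct)
  fix vs assume vs: "vs \<in> tuples M k"
  note len = tuples_length[OF vs]
  have eq: "single1 (vs[i := lact M A (lact M B (vs ! i))]) - single1 (vs[i := lact M (glxy_bracket A B) (vs ! i)])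
      - single1 (vs[i := lact M B (lact M A (vs ! i))]) \<in> W" if "i < k" for i
    using rel_add[OF vs that, of "lact M (glxy_bracket A B) (vs ! i)" "lact M B (lact M A (vs ! i))"]
      tuples_nth[OF vs that] M.lact_bracket[of "vs ! i" A B] by simp
  have "(\<Sum>i<k. \<Sum>j<k. if i = j then 0 else single1 (vs[i := lact M B (vs ! i), j := lact M A (vs ! j)]))
    = (\<Sum>j<k. \<Sum>i<k. if i = j then 0 else single1 (vs[i := lact M B (vs ! i), j := lact M A (vs ! j)]))"
    by (rule sum.swap)
  also have "\<dots> = (\<Sum>j<k. \<Sum>i<k. if j = i then 0 else single1 (vs[j := lact M A (vs ! j), i := lact M B (vs ! i)]))"
    by (intro sum.cong refl) (auto simp: list_update_swap)
  \<comment> \<open>The off-diagonal double sums for both orders of A and B are equal by the exchange of indices above.\<close>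
  finally have "leibniz (lact M A) (leibniz (lact M B) (single1 vs))
      - (leibniz (lact M (glxy_bracket A B)) (single1 vs) + leibniz (lact M B) (leibniz (lact M A) (single1 vs)))
      = (\<Sum>i<k. single1 (vs[i := lact M A (lact M B (vs ! i))]) - single1 (vs[i := lact M (glxy_bracket A B) (vs ! i)])
      - single1 (vs[i := lact M B (lact M A (vs ! i))]))"
    unfolding leibniz_leibniz_single[OF len] by (simp add: len leibniz_single sum_subtractf)
  also have "\<dots> \<in> W" by (intro W_sum eq) simp
  finally show "leibniz (lact M A) (leibniz (lact M B) (single1 vs))
      - (leibniz (lact M (glxy_bracket A B)) (single1 vs) + leibniz (lact M B) (leibniz (lact M A) (single1 vs))) \<in> W" .
qed (simp_all add: leibniz_add leibniz_pscale pm.scale_right_distrib pm.scale_right_diff_distrib)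

lemma ext_power_quot: "ext_power M k = quot_lmodule T W"
proof -
  have "quot_space T W = quot_space (tuple_space M k) W"
    by (simp add: quot_space_def A_RCOSETS_def' set_add_def' a_r_coset_def' fun_eq_iff
        vspace_def)
  moreover have "W +>\<^bsub>T\<^esub> x = W +>\<^bsub>tuple_space M k\<^esub> x" for x
    by (simp add: a_r_coset_def')
  ultimately show ?thesis by (simp add: ext_power_def quot_lmodule_def)
qed

lemma ext_power_lie_module: "lie_module (ext_power M k)"
  unfolding ext_power_quot
proof (rule operator_quotient.lie_module_quot[OF operator_quotient_T])
  have *: "\<exists>w\<in>W. x = w + y" if "x - y \<in> W" for x y
    using that by (intro bexI[of _ "x - y"]) auto
  fix x A B c assume "x \<in> carrier T"
  then have x: "Poly_Mapping.keys x \<subseteq> tuples M k" by (simp add: T_carrier)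
  show "\<exists>w\<in>W. lact T (A + B) x = w \<oplus>\<^bsub>T\<^esub> (lact T A x \<oplus>\<^bsub>T\<^esub> lact T B x)"
    unfolding T_simps by (rule *[OF leibniz_add_left[OF x]])
  show "\<exists>w\<in>W. lact T (glxy_scale c A) x = w \<oplus>\<^bsub>T\<^esub> (c \<odot>\<^bsub>T\<^esub> lact T A x)"
    unfolding T_simps by (rule *[OF leibniz_scale_left[OF x]])
  show "\<exists>w\<in>W. lact T A (lact T B x) = w \<oplus>\<^bsub>T\<^esub> (lact T (glxy_bracket A B) x \<oplus>\<^bsub>T\<^esub> lact T B (lact T A x))"
    unfolding T_simps by (rule *[OF leibniz_bracket[OF x]])
qed

end

subsection \<open>Functoriality of exterior powers\<close>

text \<open>The linear extension of applying \<^term>\<open>f\<close> to all entries of a tuple.\<close>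

definition tuple_map :: "('a \<Rightarrow> 'b) \<Rightarrow> ('a list \<Rightarrow>\<^sub>0 complex) \<Rightarrow> ('b list \<Rightarrow>\<^sub>0 complex)" where
  "tuple_map f p = (\<Sum>vs\<in>Poly_Mapping.keys p. Poly_Mapping.single (map f vs) (Poly_Mapping.lookup p vs))"

lemma tuple_map_add: "tuple_map f (p + q) = tuple_map f p + tuple_map f q"
  unfolding tuple_map_def
  by (rule setsum_keys_plus_distrib) (simp_all add: single_add)

lemma tuple_map_zero [simp]: "tuple_map f 0 = 0"
  by (simp add: tuple_map_def)

lemma tuple_map_single [simp]: "tuple_map f (Poly_Mapping.single vs c) = Poly_Mapping.single (map f vs) c"
  by (cases "c = 0") (simp_all add: tuple_map_def)

lemma tuple_map_pscale: "tuple_map f (pscale c p) = pscale c (tuple_map f p)"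
  by (induction p rule: poly_mapping_add_induct)
     (simp_all add: tuple_map_add pm.scale_right_distrib)

lemma tuple_map_sum: "tuple_map f (sum g I) = (\<Sum>i\<in>I. tuple_map f (g i))"
  by (induction I rule: infinite_finite_induct) (simp_all add: tuple_map_add)

lemma tuple_map_diff: "tuple_map f (p - q) = tuple_map f p - tuple_map f q"
  using tuple_map_add[of f "p - q" q] by simp

lemma tuple_map_inverse: "(\<And>x. g (f x) = x) \<Longrightarrow> tuple_map g (tuple_map f p) = p"
  by (induction p rule: poly_mapping_add_induct) (simp_all add: tuple_map_add comp_def)

locale exterior_map = E: exterior M k + E': exterior M' k
  for M :: "('n::finite glxy, 'a) lmodule" and M' :: "('n glxy, 'b) lmodule" and k +
  fixes f :: "'a \<Rightarrow> 'b"
  assumes linear: "linear_iso f M M'"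
begin

lemma f_closed: "x \<in> carrier M \<Longrightarrow> f x \<in> carrier M'"
  using linear by (auto simp: linear_iso_def bij_betw_def)

lemma map_tuples: "vs \<in> tuples M k \<Longrightarrow> map f vs \<in> tuples M' k"
  by (auto simp: tuples_def f_closed)

lemma tuple_map_keys:
  assumes "Poly_Mapping.keys p \<subseteq> tuples M k"
  shows "Poly_Mapping.keys (tuple_map f p) \<subseteq> tuples M' k"
proof -
  have "tuple_map f p \<in> {p. Poly_Mapping.keys p \<subseteq> tuples M' k}"
    unfolding tuple_map_def
    by (intro pm.subspace_sum[OF keys_subset_subspace]) (use assms map_tuples in auto)
  then show ?thesis by simp
qed

lemma tuple_map_W:
  assumes "p \<in> wedge_relations M k" shows "tuple_map f p \<in> wedge_relations M' k"
proof -
  have "p \<in> {p. tuple_map f p \<in> wedge_relations M' k}"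
    using assms
  proof (rule E.W_cases)
    show "pm.subspace {p. tuple_map f p \<in> wedge_relations M' k}"
      using E'.W_subspace by (simp add: pm.subspace_def tuple_map_add tuple_map_pscale)
  next
    fix vs i x y assume "vs \<in> tuples M k" "i < k" "x \<in> carrier M" "y \<in> carrier M"
    then show "single1 (vs[i := x \<oplus>\<^bsub>M\<^esub> y]) - single1 (vs[i := x]) - single1 (vs[i := y])
        \<in> {p. tuple_map f p \<in> wedge_relations M' k}"
      using E'.rel_add[of "map f vs" i "f x" "f y"] map_tuples[of vs] f_closed linear
      by (simp add: tuple_map_diff map_update linear_iso_def)
  next
    fix vs i c x assume "vs \<in> tuples M k" "i < k" "x \<in> carrier M"
    then show "single1 (vs[i := c \<odot>\<^bsub>M\<^esub> x]) - Poly_Mapping.single (vs[i := x]) c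
        \<in> {p. tuple_map f p \<in> wedge_relations M' k}"
      using E'.rel_smult[of "map f vs" i "f x" c] map_tuples[of vs] f_closed linear
      by (simp add: tuple_map_diff map_update linear_iso_def)
  next
    fix vs assume "vs \<in> tuples M k" "\<not> distinct vs"
    then show "single1 vs \<in> {p. tuple_map f p \<in> wedge_relations M' k}"
      using E'.rel_alt[of "map f vs"] map_tuples[of vs] by (simp add: distinct_map)
  qed
  then show ?thesis by simp
qed

lemma tuple_map_leibniz:
  assumes "intertwines f M M' A B" "Poly_Mapping.keys p \<subseteq> tuples M k"
  shows "tuple_map f (leibniz (lact M A) p) = leibniz (lact M' B) (tuple_map f p)"
proof -
  have "tuple_map f (leibniz (lact M A) (single1 vs)) = leibniz (lact M' B) (tuple_map f (single1 vs))"
    if vs: "vs \<in> tuples M k" for vs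
    using assms(1) E.tuples_nth[OF vs] E.tuples_length[OF vs]
    by (simp add: leibniz_single tuple_map_sum map_update intertwines_def)
  then have "p \<in> {p. tuple_map f (leibniz (lact M A) p) = leibniz (lact M' B) (tuple_map f p)}"
    using keys_subset_span[OF assms(2)]
    by (elim pm.span_induct)
       (auto simp: pm.subspace_def tuple_map_add leibniz_add tuple_map_pscale leibniz_pscale)
  then show ?thesis by simp
qed

end

lemma linear_iso_inverse:
  assumes "linear_iso f M M'" "\<And>x. g (f x) = x" "complex_space M"
  shows "linear_iso g M' M"
proof -
  interpret complex_space M by fact
  have c: "carrier M' = f ` carrier M" using assms(1) by (simp add: linear_iso_def bij_betw_def)
  have "bij_betw g (carrier M') (carrier M)"
    unfolding c by (rule bij_betw_imageI) (auto simp: inj_on_def assms(2) image_image)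
  moreover have "g (f x \<oplus>\<^bsub>M'\<^esub> f y) = x \<oplus>\<^bsub>M\<^esub> y" "g (c \<odot>\<^bsub>M'\<^esub> f x) = c \<odot>\<^bsub>M\<^esub> x"
    if "x \<in> carrier M" "y \<in> carrier M" for x y c
    using assms(1,2) that unfolding linear_iso_def by metis+
  ultimately show ?thesis by (auto simp: linear_iso_def c assms(2))
qed

text \<open>Asking for an inverse on the whole type gives an inverse on tuples as well, so that surjectivity on
relations and on carriers follows from the inclusions for both maps. The translation of cosets by
a power of \<open>x\<close> is invertible on arbitrary sets of vectors.\<close>

lemma ext_power_transport:
  fixes M :: "('n::finite glxy, 'a) lmodule" and M' :: "('n glxy, 'b) lmodule"
  assumes "lie_module M" "lie_module M'" "linear_iso f M M'"
    and inv: "\<And>x. g (f x) = x" "\<And>y. f (g y) = y"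
  shows "linear_iso ((`) (tuple_map f)) (ext_power M k) (ext_power M' k)"
    and "intertwines f M M' A B \<Longrightarrow>
      intertwines ((`) (tuple_map f)) (ext_power M k) (ext_power M' k) A B"
    and "vs \<in> tuples M k \<Longrightarrow> tuple_map f ` wedge M vs = wedge M' (map f vs)"
proof -
  interpret E: exterior_map M M' k f
    by (intro exterior_map.intro exterior.intro exterior_map_axioms.intro assms)
  interpret G: exterior_map M' M k g
    by (intro exterior_map.intro exterior.intro exterior_map_axioms.intro assms
        linear_iso_inverse[OF assms(3)] complex_space.axioms lie_module.axioms)
  let ?T = E.E.T and ?T' = E.E'.T
  have bij: "tuple_map g (tuple_map f p) = p" "tuple_map f (tuple_map g q) = q" for p q
    by (rule tuple_map_inverse, rule inv)+
  have W: "tuple_map f ` wedge_relations M k = wedge_relations M' k"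
    using E.tuple_map_W G.tuple_map_W bij(2) by (auto simp: image_iff) metis
  have "bij_betw (tuple_map f) (carrier ?T) (carrier ?T')"
    by (rule bij_betw_byWitness[where f' = "tuple_map g"])
       (simp_all add: bij image_subset_iff E.tuple_map_keys G.tuple_map_keys)
  then have lin: "linear_iso (tuple_map f) ?T ?T'"
    by (simp add: linear_iso_def E.E.T_simps E.E'.T_simps tuple_map_add tuple_map_pscale
        del: with_action_simps)
  note tr = operator_quotient_transport[OF E.E.operator_quotient_T E.E'.operator_quotient_T lin W]
  show "linear_iso ((`) (tuple_map f)) (ext_power M k) (ext_power M' k)"
    unfolding E.E.ext_power_quot E.E'.ext_power_quot by (rule tr(1))
  show "intertwines ((`) (tuple_map f)) (ext_power M k) (ext_power M' k) A B"
    if "intertwines f M M' A B"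
    unfolding E.E.ext_power_quot E.E'.ext_power_quot
    by (rule tr(2)) (use E.tuple_map_leibniz[OF that] in
        \<open>simp add: intertwines_def[of "tuple_map f"] E.E.T_simps E.E'.T_simps E.E.T_carrier del: with_action_simps\<close>)
  show "tuple_map f ` wedge M vs = wedge M' (map f vs)" if "vs \<in> tuples M k"
    using linear_iso_coset[OF E.E.T_space E.E'.T_space lin E.E.W_subspace_of W, of "single1 vs"] that
    by (simp add: wedge_def E.E.tuples_length E.E.T_carrier a_r_coset_def' E.E.T_simps E.E'.T_simps tuple_space_def)
qed

section \<open>Twisting by a power of x\<close>

subsection \<open>The action on Laurent polynomials\<close>

lemma xy_act_abs: "xy_act (abs_xyalg p) = free_act xygen_act p"
  by (rule xy_act.abs_eq)

lemma xyalg_cases: obtains p where "a = abs_xyalg p"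
  by (metis Quotient3_abs_rep[OF Quotient3_xyalg])

lemma xy_act_plus_left: "xy_act (a + b) f = xy_act a f + xy_act b f"
  by transfer (rule free_act_add)

lemma xy_act_minus_left: "xy_act (a - b) f = xy_act a f - xy_act b f"
  by transfer (rule free_act_diff)

lemma xy_act_times: "xy_act (a * b) f = xy_act a (xy_act b f)"
  by transfer (rule xy_free_act_mult)

lemma free_act_const: "free_act act (Poly_Mapping.single 0 c) f = pscale c f"
  by (simp add: word_act_def zero_word_def)

lemma xy_act_xyscale: "xy_act (xyscale c a) f = pscale c (xy_act a f)"
  by transfer (simp add: xy_free_act_mult free_act_const del: free_act_single)

lemma xy_act_one [simp]: "xy_act 1 f = f"
  by transfer (simp add: free_act_const del: free_act_single single_one flip: single_one)

lemma xy_act_X: "xy_act xyX f = Poly_Mapping.single 1 1 * f"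
  by transfer simp

lemma xy_act_Y: "xy_act xyY f = xD f"
  by transfer simp

lemmas xy_word_act_linear =
  word_act_linear[of xygen_act, OF xygen_act_add xygen_act_scale]

lemma xy_act_plus: "xy_act a (f + g) = xy_act a f + xy_act a g"
  by transfer (simp add: free_act_def xy_word_act_linear pm.scale_right_distrib sum.distrib)

lemma xy_act_pscale: "xy_act a (pscale c f) = pscale c (xy_act a f)"
  by transfer (simp add: free_act_def xy_word_act_linear pm.scale_sum_right mult.commute)

lemma xy_act_sum: "xy_act a (sum f I) = (\<Sum>i\<in>I. xy_act a (f i))"
  using xy_act_pscale[of a 0 0]
  by (induction I rule: infinite_finite_induct) (simp_all add: xy_act_plus)

lemma xy_act_zero_left [simp]: "xy_act 0 f = 0"
  using xy_act_minus_left[of 0 0 f] by simp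

lemma xy_act_sum_left: "xy_act (sum a I) f = (\<Sum>i\<in>I. xy_act (a i) f)"
  by (induction I rule: infinite_finite_induct) (simp_all add: xy_act_plus_left)

subsection \<open>Multiplication by a power of x\<close>

abbreviation xpow :: "int \<Rightarrow> laurent" where
  "xpow c \<equiv> Poly_Mapping.single c 1"

lemma xpow_mult: "xpow c * (xpow d * f) = xpow (c + d) * f"
  by (simp add: mult_single flip: mult.assoc)

lemma lookup_xpow_mult: "Poly_Mapping.lookup (xpow c * f) i = Poly_Mapping.lookup f (i - c)"
proof -
  have "(i = c + q) = (q = i - c)" for q by auto
  then show ?thesis by (simp add: lookup_mult lookup_single when_mult)
qed

lemma xpow_pscale: "xpow c * pscale d f = pscale d (xpow c * f)"
  by (rule poly_mapping_eqI) (simp add: lookup_xpow_mult)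

text \<open>Conjugation with \<open>x\<^sup>c\<close> turns the operator \<^term>\<open>a\<close> into \<^term>\<open>b\<close>. As a relation
it can be used without knowing that the algebra acts faithfully or that the substitution of
\<open>Y - c\<close> for \<open>Y\<close> extends to an automorphism.\<close>

definition xy_twist :: "int \<Rightarrow> xyalg \<Rightarrow> xyalg \<Rightarrow> bool" where
  "xy_twist c a b \<longleftrightarrow> (\<forall>f. xpow c * xy_act a f = xy_act b (xpow c * f))"

lemma xy_twist_add: "xy_twist c a b \<Longrightarrow> xy_twist c a' b' \<Longrightarrow> xy_twist c (a + a') (b + b')"
  by (simp add: xy_twist_def xy_act_plus_left distrib_left)

lemma xy_twist_scale: "xy_twist c a b \<Longrightarrow> xy_twist c (xyscale d a) (xyscale d b)"
  by (simp add: xy_twist_def xy_act_xyscale xpow_pscale)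

lemma xy_twist_mult: "xy_twist c a b \<Longrightarrow> xy_twist c a' b' \<Longrightarrow> xy_twist c (a * a') (b * b')"
  by (simp add: xy_twist_def xy_act_times)

lemma xy_twist_one: "xy_twist c 1 1"
  by (simp add: xy_twist_def)

lemma xy_twist_power: "xy_twist c a b \<Longrightarrow> xy_twist c (a ^ n) (b ^ n)"
  by (induction n) (simp_all add: xy_twist_one xy_twist_mult)

lemma xy_twist_X: "xy_twist c xyX xyX"
  by (simp add: xy_twist_def xy_act_X mult.left_commute)

text \<open>By the product rule, \<open>x d/dx (x\<^sup>c f) = x\<^sup>c (x d/dx f) + c x\<^sup>c f\<close>.\<close>

lemma xy_twist_Y: "xy_twist c xyY (xyY - xyscale (of_int c) 1)"
  unfolding xy_twist_def
  by (intro allI poly_mapping_eqI)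
     (simp add: xy_act_minus_left xy_act_Y xy_act_xyscale lookup_xpow_mult lookup_minus left_diff_distrib)

lemma xy_twist_sym:
  assumes "xy_twist c a b" shows "xy_twist (- c) b a"
  unfolding xy_twist_def
proof
  fix f
  have "xpow (- c) * xy_act b (xpow c * (xpow (- c) * f)) = xpow (- c) * (xpow c * xy_act a (xpow (- c) * f))"
    using assms by (simp add: xy_twist_def)
  then show "xpow (- c) * xy_act b f = xy_act a (xpow (- c) * f)"
    unfolding xpow_mult by simp
qed

text \<open>The filtration with its index shifted by one, so that the zero subspace below degree 0 is
included.\<close>

definition xy_below :: "nat \<Rightarrow> xyalg set" where
  "xy_below n = xy.span {xyX ^ i * xyY ^ j | i j. j < n}"

lemma xy_below_Suc: "xy_below (Suc n) = xy_filt n"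
  by (simp add: xy_below_def xy_filt_def less_Suc_eq_le)

lemma xy_below_0: "xy_below 0 = {0}"
  by (simp add: xy_below_def)

lemma xy_below_mono: "m \<le> n \<Longrightarrow> xy_below m \<subseteq> xy_below n"
  unfolding xy_below_def by (intro xy.span_mono) (fastforce)

lemma xy_below_zero: "0 \<in> xy_below n"
  unfolding xy_below_def by (rule xy.span_zero)

lemma xy_below_add: "a \<in> xy_below n \<Longrightarrow> b \<in> xy_below n \<Longrightarrow> a + b \<in> xy_below n"
  unfolding xy_below_def by (rule xy.span_add)

lemma xy_below_diff: "a \<in> xy_below n \<Longrightarrow> b \<in> xy_below n \<Longrightarrow> a - b \<in> xy_below n"
  unfolding xy_below_def by (rule xy.span_diff)

lemma xy_below_scale: "a \<in> xy_below n \<Longrightarrow> xyscale c a \<in> xy_below n"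
  unfolding xy_below_def by (rule xy.span_scale)

lemma xyscale_mult_left: "xyscale c a * b = xyscale c (a * b)"
  by transfer (simp add: mult.assoc equivp_reflp[OF equivp_ideal_cong])

lemma free_algebra_const_commute:
  fixes p :: "'g free_algebra"
  shows "p * Poly_Mapping.single 0 c = Poly_Mapping.single 0 c * p"
  by (induction p rule: poly_mapping_add_induct)
     (simp_all add: mult_single distrib_left distrib_right mult.commute)

lemma xyscale_mult_right: "a * xyscale c b = xyscale c (a * b)"
  by transfer (simp add: free_algebra_const_commute equivp_reflp[OF equivp_ideal_cong] flip: mult.assoc)

lemma xy_below_mult_Y:
  assumes "a \<in> xy_below n" shows "a * xyY \<in> xy_below (Suc n)"
proof -
  have "xyX ^ i * xyY ^ j * xyY \<in> xy_below (Suc n)" if "j < n" for i j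
    unfolding xy_below_def
  proof (rule xy.span_base, rule CollectI, rule exI[of _ i], rule exI[of _ "Suc j"], rule conjI)
    show "xyX ^ i * xyY ^ j * xyY = xyX ^ i * xyY ^ Suc j"
      by (simp add: mult.assoc power_Suc2 del: power_Suc)
  qed (use that in simp)
  then show ?thesis
    using assms[unfolded xy_below_def]
    by (elim xy.span_induct)
       (auto simp: xy.subspace_def distrib_right xyscale_mult_left xy_below_zero xy_below_add
          xy_below_scale)
qed

text \<open>Replacing \<open>Y\<close> by \<open>Y - c\<close> does not change the leading term. Multiplying the claim for
\<^term>\<open>j\<close> by \<open>Y - c\<close> from the right avoids commuting \<open>X\<close> with \<open>Y\<close>.\<close>

lemma xy_shift_monomial:
  "xyX ^ i * (xyY - xyscale c 1) ^ j - xyX ^ i * xyY ^ j \<in> xy_below j"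
proof (induction j)
  case 0
  show ?case by (simp add: xy_below_0)
next
  case (Suc j)
  let ?Z = "xyX ^ i * (xyY - xyscale c 1) ^ j" and ?M = "xyX ^ i * xyY ^ j"
  have "?M \<in> xy_below (Suc j)"
    unfolding xy_below_def by (rule xy.span_base) auto
  moreover have "?Z - ?M \<in> xy_below (Suc j)" using Suc xy_below_mono[of j "Suc j"] by auto
  \<comment> \<open>All terms of the product of (?Z - ?M) + ?M with Y - c, except the leading ?M * Y.\<close>
  ultimately have "(?Z - ?M) * xyY - xyscale c (?M + (?Z - ?M)) \<in> xy_below (Suc j)"
    by (intro xy_below_diff[OF xy_below_mult_Y[OF Suc] xy_below_scale[OF xy_below_add]])
  also have "(?Z - ?M) * xyY - xyscale c (?M + (?Z - ?M))
      = xyX ^ i * (xyY - xyscale c 1) ^ Suc j - xyX ^ i * xyY ^ Suc j"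
    by (simp add: power_Suc2 mult.assoc[symmetric] left_diff_distrib right_diff_distrib xyscale_mult_right
        del: power_Suc)
  finally show ?case .
qed

text \<open>Only the monomials that span the filtration have to be twisted, and for these the partner is
\<open>X\<^sup>i (Y - c)\<^sup>j\<close>.\<close>

lemma xy_twist_exists:
  assumes "a \<in> xy_filt n"
  shows "\<exists>b. xy_twist c a b \<and> b - a \<in> xy_below n"
  using assms unfolding xy_filt_def
proof (induction rule: xy.span_induct_alt)
  case base
  have "xy_twist c 0 0" by (simp add: xy_twist_def)
  then show ?case
    using xy.span_zero unfolding xy_below_def by (intro exI[of _ 0]) simp
next
  case (step d a a')
  then obtain i j where a: "a = xyX ^ i * xyY ^ j" "j \<le> n" by blast
  from step obtain b' where b': "xy_twist c a' b'" "b' - a' \<in> xy_below n" by blast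
  let ?b = "xyX ^ i * (xyY - xyscale (of_int c) 1) ^ j"
  have "xy_twist c a ?b"
    unfolding a by (intro xy_twist_mult xy_twist_power xy_twist_X xy_twist_Y)
  moreover have "?b - a \<in> xy_below n"
    using xy_shift_monomial[of i "of_int c" j] xy_below_mono[OF a(2)] unfolding a by blast
  then have "xyscale d (?b - a) + (b' - a') \<in> xy_below n" 
    by (rule xy_below_add[OF xy_below_scale b'(2)])
  then have "(xyscale d ?b + b') - (xyscale d a + a') \<in> xy_below n"
    by (simp add: xy.scale_right_diff_distrib algebra_simps)
  ultimately show ?case using b' by (blast intro: xy_twist_add xy_twist_scale)
qed

definition glxy_twist :: "int \<Rightarrow> 'n::finite glxy \<Rightarrow> 'n glxy \<Rightarrow> bool" where
  "glxy_twist c A B \<longleftrightarrow> (\<forall>i j. xy_twist c (A $ i $ j) (B $ i $ j))"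

lemma glxy_twist_sym: "glxy_twist c A B \<Longrightarrow> glxy_twist (- c) B A"
  by (simp add: glxy_twist_def xy_twist_sym)

lemma glxy_twist_exists:
  fixes A :: "'n::finite glxy"
  assumes "A \<in> glxy_filt n"
  shows "\<exists>B. glxy_twist c A B \<and> same_symbol n A B"
proof -
  have "\<exists>b. xy_twist c (A $ i $ j) b \<and> b - A $ i $ j \<in> xy_below n" for i j
    using assms by (intro xy_twist_exists) (simp add: glxy_filt_def)
  then obtain b where b: "\<And>i j. xy_twist c (A $ i $ j) (b i j)" "\<And>i j. b i j - A $ i $ j \<in> xy_below n"
    by metis
  define B :: "'n glxy" where "B = (\<chi> i j. b i j)"
  have "glxy_twist c A B" using b(1) by (simp add: glxy_twist_def B_def)
  moreover have "same_symbol n A B"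
  proof -
    have "b i j \<in> xy_filt n" for i j
    proof -
      have "b i j - A $ i $ j \<in> xy_filt n"
        using b(2)[of i j] xy_below_mono[of n "Suc n"] by (auto simp: xy_below_Suc)
      moreover have "A $ i $ j \<in> xy_filt n" using assms by (simp add: glxy_filt_def)
      ultimately have "(b i j - A $ i $ j) + A $ i $ j \<in> xy_filt n"
        unfolding xy_below_Suc[symmetric] by (rule xy_below_add)
      then show ?thesis by simp
    qed
    moreover have "A = B" if "n = 0"
      using b(2) that by (simp add: B_def vec_eq_iff xy_below_0)
    moreover have "B - A \<in> glxy_filt (n - 1)" if "n \<noteq> 0"
      using b(2) that xy_below_Suc[of "n - 1"] by (simp add: glxy_filt_def B_def)
    ultimately show ?thesis using assms by (auto simp: same_symbol_def glxy_filt_def B_def)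
  qed
  ultimately show ?thesis by blast
qed

text \<open>With this, partners for a given right-hand side come from twisting with \<open>-c\<close>.\<close>

lemma same_symbol_sym:
  assumes "same_symbol n A B" shows "same_symbol n B A"
proof -
  have "A - B \<in> glxy_filt m" if "B - A \<in> glxy_filt m" for m
  proof -
    have "- ((B - A) $ i $ j) \<in> xy_filt m" for i j
      using that unfolding glxy_filt_def xy_filt_def by (intro xy.span_neg) blast
    then show ?thesis by (simp add: glxy_filt_def)
  qed
  then show ?thesis using assms by (auto simp: same_symbol_def split: if_splits)
qed

section \<open>The modules of truncated Laurent vectors\<close>

abbreviation truncation :: "int \<Rightarrow> 'n::finite lvec set" where
  "truncation N \<equiv> {f. \<forall>a. f $ a \<in> xN_polys N}"

text \<open>The membership test by coefficients makes the invariance properties calculations.\<close>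

lemma xN_polys_iff: "f \<in> xN_polys N \<longleftrightarrow> (\<forall>i<N. Poly_Mapping.lookup f i = 0)"
proof
  assume "f \<in> xN_polys N"
  then show "\<forall>i<N. Poly_Mapping.lookup f i = 0"
    by (fastforce simp: xN_polys_def lookup_xpow_mult in_keys_iff subset_iff)
next
  assume f: "\<forall>i<N. Poly_Mapping.lookup f i = 0"
  have "f = xpow N * (xpow (- N) * f)" by (simp add: xpow_mult)
  moreover have "Poly_Mapping.keys (xpow (- N) * f) \<subseteq> {0..}"
    using f by (auto simp: in_keys_iff lookup_xpow_mult) (meson linorder_not_less add_less_same_cancel2)
  ultimately show "f \<in> xN_polys N" unfolding xN_polys_def by blast
qed

lemma xN_polys_add: "f \<in> xN_polys N \<Longrightarrow> g \<in> xN_polys N \<Longrightarrow> f + g \<in> xN_polys N"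
  by (simp add: xN_polys_iff lookup_add)

lemma xN_polys_zero: "0 \<in> xN_polys N"
  by (simp add: xN_polys_iff)

lemma xN_polys_pscale: "f \<in> xN_polys N \<Longrightarrow> pscale c f \<in> xN_polys N"
  by (simp add: xN_polys_iff)

lemma xN_polys_sum: "(\<And>i. i \<in> I \<Longrightarrow> f i \<in> xN_polys N) \<Longrightarrow> sum f I \<in> xN_polys N"
  by (induction I rule: infinite_finite_induct) (simp_all add: xN_polys_zero xN_polys_add)

lemma xN_polys_act:
  assumes "f \<in> xN_polys N" shows "xy_act a f \<in> xN_polys N"
proof -
  have g: "xygen_act g h \<in> xN_polys N" if "h \<in> xN_polys N" for g h
    using that by (cases g) (auto simp: xN_polys_iff)
  have "foldr xygen_act l f \<in> xN_polys N" for l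
    by (induction l) (simp_all add: assms g)
  then have w: "word_act xygen_act w f \<in> xN_polys N" for w
    by (simp add: word_act_def)
  obtain p where "a = abs_xyalg p" by (rule xyalg_cases)
  then show ?thesis
    by (simp add: xy_act_abs free_act_def w xN_polys_sum xN_polys_pscale)
qed

lemma xpow_xN_polys: "f \<in> xN_polys N \<Longrightarrow> xpow c * f \<in> xN_polys (N + c)"
  by (simp add: xN_polys_iff lookup_xpow_mult)

definition lvec_scale :: "complex \<Rightarrow> 'n::finite lvec \<Rightarrow> 'n lvec" where
  "lvec_scale c f = (\<chi> a. pscale c (f $ a))"

lemma laurent_simps [simp]:
  "carrier laurent_module = UNIV" "add laurent_module = (+)" "zero laurent_module = 0"
  "smult laurent_module = lvec_scale"
  "lact laurent_module A f = (\<chi> a. \<Sum>b\<in>UNIV. xy_act (A $ a $ b) (f $ b))"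
  by (simp_all add: laurent_module_def lvec_scale_def fun_eq_iff)

lemma laurent_space: "complex_space laurent_module"
proof -
  interpret V: vector_space lvec_scale
    by unfold_locales (simp_all add: lvec_scale_def vec_eq_iff pm.scale_right_distrib pm.scale_left_distrib)
  have "complex_space (vspace UNIV (+) 0 lvec_scale)"
    by (rule vspace_complex_space[OF V.vector_space_axioms]) (simp add: V.subspace_def)
  then show ?thesis
    by (rule complex_space_cong[rotated 4]) simp_all
qed

lemma laurent_operator_quotient: "operator_quotient laurent_module (truncation N)"
  by (intro operator_quotient.intro operator_quotient_axioms.intro laurent_space)
     (auto simp: subspace_of_def lvec_scale_def vec_eq_iff xN_polys_zero xN_polys_add xN_polys_pscale
        xN_polys_sum xN_polys_act xy_act_plus xy_act_pscale sum.distrib pm.scale_sum_right)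

lemma laurent_bracket:
  fixes A B :: "'n::finite glxy"
  shows "lact laurent_module A (lact laurent_module B f) =
    lact laurent_module (glxy_bracket A B) f + lact laurent_module B (lact laurent_module A f)"
proof -
  have prod: "lact laurent_module A (lact laurent_module B f) = lact laurent_module (A ** B) f"
    for A B :: "'n glxy"
  proof -
    have "(\<Sum>b\<in>UNIV. \<Sum>c\<in>UNIV. xy_act (A $ a $ b) (xy_act (B $ b $ c) (f $ c)))
        = (\<Sum>c\<in>UNIV. \<Sum>b\<in>UNIV. xy_act (A $ a $ b) (xy_act (B $ b $ c) (f $ c)))" for a
      by (rule sum.swap)
    then show ?thesis
      by (simp add: vec_eq_iff matrix_matrix_mult_def xy_act_sum xy_act_sum_left xy_act_times)
  qed
  show ?thesis
    unfolding prod
    by (simp add: glxy_bracket_def vec_eq_iff xy_act_minus_left sum_subtractf)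
qed

lemma VN_lie_module: "lie_module (VN N :: ('n::finite glxy, 'n lvec set) lmodule)"
  unfolding VN_def
proof (rule operator_quotient.lie_module_quot[OF laurent_operator_quotient])
  have zero: "0 \<in> (truncation N :: 'n lvec set)" by (simp add: xN_polys_zero)
  have *: "\<exists>w\<in>(truncation N :: 'n lvec set). x = w + y" if "x = y" for x y
    using zero that by (intro bexI[of _ 0]) auto
  fix A B :: "'n glxy" and c and x :: "'n lvec"
  show "\<exists>w\<in>truncation N. lact laurent_module (A + B) x =
      w \<oplus>\<^bsub>laurent_module\<^esub> (lact laurent_module A x \<oplus>\<^bsub>laurent_module\<^esub> lact laurent_module B x)"
    unfolding laurent_simps(2) by (rule *) (simp add: vec_eq_iff xy_act_plus_left sum.distrib)
  show "\<exists>w\<in>truncation N. lact laurent_module (glxy_scale c A) x =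
      w \<oplus>\<^bsub>laurent_module\<^esub> (c \<odot>\<^bsub>laurent_module\<^esub> lact laurent_module A x)"
    unfolding laurent_simps(2) 
    by (rule *) (simp add: vec_eq_iff lvec_scale_def glxy_scale_def xy_act_xyscale pm.scale_sum_right)
  show "\<exists>w\<in>truncation N. lact laurent_module A (lact laurent_module B x) =
      w \<oplus>\<^bsub>laurent_module\<^esub> (lact laurent_module (glxy_bracket A B) x \<oplus>\<^bsub>laurent_module\<^esub>
        lact laurent_module B (lact laurent_module A x))"
    unfolding laurent_simps(2) by (rule *) (rule laurent_bracket)
qed

definition xshift :: "int \<Rightarrow> 'n::finite lvec \<Rightarrow> 'n lvec" where
  "xshift c f = (\<chi> a. xpow c * (f $ a))"

lemma xshift_xshift: "xshift c (xshift d f) = xshift (c + d) f"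
  by (simp add: xshift_def vec_eq_iff xpow_mult)

lemma xshift_zero [simp]: "xshift 0 f = f"
  by (simp add: xshift_def vec_eq_iff)

lemma xshift_linear_iso: "linear_iso (xshift c) laurent_module laurent_module"
proof -
  have "bij (xshift c :: 'a lvec \<Rightarrow> _)"
    by (rule o_bij[of "xshift (- c)"]) (simp_all add: fun_eq_iff xshift_xshift)
  then show ?thesis
    by (simp add: linear_iso_def xshift_def vec_eq_iff distrib_left lvec_scale_def xpow_pscale)
qed

lemma xshift_truncation: "xshift c ` truncation N = (truncation (N + c) :: 'n::finite lvec set)"
proof (intro equalityI subsetI)
  fix f :: "'n lvec" assume "f \<in> truncation (N + c)"
  then have "xshift (- c) f \<in> truncation N"
    using xpow_xN_polys[of _ "N + c" "- c"] by (simp add: xshift_def)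
  moreover have "f = xshift c (xshift (- c) f)" by (simp add: xshift_xshift)
  ultimately show "f \<in> xshift c ` truncation N" by blast
qed (auto simp: xshift_def xpow_xN_polys)

lemma xshift_intertwines:
  "glxy_twist c A B \<Longrightarrow> intertwines (xshift c) laurent_module laurent_module A B"
  by (simp add: intertwines_def xshift_def vec_eq_iff sum_distrib_left glxy_twist_def xy_twist_def)

text \<open>Everything about \<open>V(N)\<close> that enters the theorem is moved by \<open>x\<^sup>c\<close> to
the same thing for \<open>N + c\<close>, except for the action, which is twisted.\<close>

lemma xshift_VN:
  "linear_iso ((`) (xshift c)) (VN N) (VN (N + c) :: ('n::finite glxy, 'n lvec set) lmodule)"
  "glxy_twist c A B \<Longrightarrow> intertwines ((`) (xshift c)) (VN N) (VN (N + c)) A B"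
  "xshift c ` VN_basis N j i = VN_basis (N + c) j (i + c)"
proof -
  note tr = operator_quotient_transport[OF laurent_operator_quotient[of N]
      laurent_operator_quotient[of "N + c"] xshift_linear_iso xshift_truncation, folded VN_def]
  show "linear_iso ((`) (xshift c)) (VN N) (VN (N + c))" by (rule tr(1))
  show "intertwines ((`) (xshift c)) (VN N) (VN (N + c)) A B" if "glxy_twist c A B"
    by (rule tr(2)[OF xshift_intertwines[OF that]])
  have "xshift c (axis j (xpow i)) = axis j (xpow (i + c))"
    by (simp add: xshift_def vec_eq_iff axis_def mult_single add.commute)
  then show "xshift c ` VN_basis N j i = VN_basis (N + c) j (i + c)"
    unfolding VN_basis_def
    by (subst linear_iso_coset[OF laurent_space laurent_space xshift_linear_iso
          operator_quotient.W[OF laurent_operator_quotient] xshift_truncation])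
       simp_all
qed

definition xi_basis :: "('n::{finite,linorder} \<Rightarrow> nat) \<Rightarrow> int \<Rightarrow> 'n lvec set list" where
  "xi_basis \<xi> N = concat (map (\<lambda>j. map (VN_basis N j) [N - int (\<xi> j)..N - 1]) (sorted_list_of_set UNIV))"

lemma VN_basis_carrier: "VN_basis N j i \<in> carrier (VN N)"
proof -
  interpret complex_space laurent_module by (rule laurent_space)
  show ?thesis by (simp add: VN_def VN_basis_def quot_lmodule_simps quot_carrier)
qed

lemma xi_basis_tuples: "xi_basis \<xi> N \<in> tuples (VN N) (\<Sum>j\<in>UNIV. \<xi> j)"
proof -
  have "length (xi_basis \<xi> N) = sum_list (map \<xi> (sorted_list_of_set UNIV))"
    by (simp add: xi_basis_def length_concat comp_def)
  also have "\<dots> = (\<Sum>j\<in>UNIV. \<xi> j)"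
    by (subst sum_list_distinct_conv_sum_set) simp_all
  finally show ?thesis
    by (auto simp: tuples_def xi_basis_def VN_basis_carrier)
qed

lemma map_upto_shift: "map (\<lambda>i. i + c) [a..b] = [a + c..b + c :: int]"
  by (rule nth_equalityI) auto

text \<open>The exponents run over the \<^term>\<open>\<xi> j\<close> integers just below \<^term>\<open>N\<close>, so the range moves along with
\<^term>\<open>N\<close>.\<close>

lemma xi_basis_shift: "map ((`) (xshift c)) (xi_basis \<xi> N) = xi_basis \<xi> (N + c)"
proof -
  have "map ((`) (xshift c)) (map (VN_basis N j) [N - int (\<xi> j)..N - 1])
      = map (VN_basis (N + c) j) (map (\<lambda>i. i + c) [N - int (\<xi> j)..N - 1])" for j
    by (simp add: comp_def xshift_VN(3))
  also have "\<dots> j = map (VN_basis (N + c) j) [N + c - int (\<xi> j)..N + c - 1]" for j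
    by (simp add: map_upto_shift algebra_simps)
  finally show ?thesis
    by (simp add: xi_basis_def map_concat comp_def)
qed

lemma v_xi_wedge: "v_xi \<xi> N = wedge (VN N) (xi_basis \<xi> N)"
  by (simp add: v_xi_def xi_basis_def)

lemma v_xi_carrier: "v_xi \<xi> N \<in> carrier (ext_power (VN N) (\<Sum>j\<in>UNIV. \<xi> j))"
proof -
  let ?k = "\<Sum>j\<in>UNIV. \<xi> j"
  interpret E: exterior "VN N" ?k by (intro exterior.intro VN_lie_module)
  interpret T: complex_space "tuple_space (VN N) ?k"
    using E.T_space by (rule complex_space_cong[rotated 4]) simp_all
  have "length (xi_basis \<xi> N) = ?k" using xi_basis_tuples by (rule E.tuples_length)
  then show ?thesis
    using xi_basis_tuples[of \<xi> N]
    by (auto simp: v_xi_wedge wedge_def ext_power_def T.quot_carrier)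
qed

section \<open>Independence of N\<close>

theorem proposition5:
  fixes \<xi> :: "'n::{finite,linorder} \<Rightarrow> nat" and N M :: int
  assumes "antimono \<xi>"
  shows "lmodule_isomorphic (gr_module (V_xi \<xi> N) (v_xi \<xi> N)) (gr_module (V_xi \<xi> M) (v_xi \<xi> M))"
proof -
  define k where "k = (\<Sum>j\<in>UNIV. \<xi> j)"
  define c where "c = M - N"
  have M: "M = N + c" by (simp add: c_def)
  let ?E = "\<lambda>N. ext_power (VN N :: ('n glxy, 'n lvec set) lmodule) k"
  let ?f = "(`) (tuple_map ((`) (xshift c))) :: ('n lvec set list \<Rightarrow>\<^sub>0 complex) set \<Rightarrow> _"
  have inv: "xshift (- c) ` xshift c ` S = S" "xshift c ` xshift (- c) ` S = S" for S :: "'n lvec set"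
    by (simp_all add: image_image xshift_xshift)
  note tr = ext_power_transport[OF VN_lie_module VN_lie_module xshift_VN(1) inv, where k = k]
  have lie: "lie_module (?E N)" for N
    by (intro exterior.ext_power_lie_module exterior.intro VN_lie_module)
  have gen: "v_xi \<xi> N \<in> carrier (?E N)" for N
    unfolding k_def by (rule v_xi_carrier)
  have fv: "?f (v_xi \<xi> N) = v_xi \<xi> M"
    unfolding v_xi_wedge M xi_basis_shift[symmetric]
    by (rule tr(3)) (unfold k_def, rule xi_basis_tuples)
  have "symbol_iso ?f (?E N) (?E M)"
    unfolding symbol_iso_def
  proof (intro conjI allI ballI)
    show "linear_iso ?f (?E N) (?E M)" unfolding M by (rule tr(1))
  next
    fix n and A :: "'n glxy" assume "A \<in> glxy_filt n"
    then obtain B where "glxy_twist c A B" "same_symbol n A B" using glxy_twist_exists by blast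
    then show "\<exists>B. same_symbol n A B \<and> intertwines ?f (?E N) (?E M) A B"
      unfolding M using tr(2) xshift_VN(2) by blast
  next
    fix n and B :: "'n glxy" assume "B \<in> glxy_filt n"
    then obtain A where "glxy_twist (- c) B A" "same_symbol n B A" using glxy_twist_exists by blast
    then have "glxy_twist c A B" "same_symbol n A B"
      using glxy_twist_sym[of "- c" B A] same_symbol_sym by auto
    then show "\<exists>A. same_symbol n A B \<and> intertwines ?f (?E N) (?E M) A B"
      unfolding M using tr(2) xshift_VN(2) by blast
  qed
  \<comment> \<open>The exterior power serves as ambient module; the cyclic submodule has the same associated graded.\<close>
  then interpret graded_transport "?E N" "?E M" ?f "v_xi \<xi> N"
    by (intro graded_transport.intro graded_transport_axioms.intro lie gen)
  show ?thesis
    using gr_module_isomorphic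
    unfolding V_xi_def k_def[symmetric] M.gr_module_cyclic[OF gen] M'.gr_module_cyclic[OF gen] fv .
qed

end
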